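(* Let $\psi\in L^2(\mathbb R)$, $\psi\neq 0$, and let $N\in\mathbb N$, $N>1$. The following are equivalent: (a) $\langle \psi\rangle_{\mathbb Z}$ is $\frac1N\mathbb Z$ invariant, i.e. $T_{k/N}f\in\langle\psi\rangle_{\mathbb Z}$ for all $f\in\langle\psi\rangle_{\mathbb Z}$ and all $k\in\mathbb Z$. (b) $Z_N(\psi)(x,\xi+p)\,Z_N(\psi)(y,\xi+q)=0$ for a.e. $x,y\in[0,1/N)$, a.e. $\xi\in[0,1)$, and for all $p,q\in\{0,1,\dots,N-1\}$ with $p\neq q$.
   Context: For $h\in\mathbb R$, $T_h f(x)=f(x-h)$. For $\psi\in L^2(\mathbb R)$, $\langle\psi\rangle_{\mathbb Z}=\overline{\operatorname{span}}\{T_k\psi:k\in\mathbb Z\}$ (closure in $L^2(\mathbb R)$). For $N\in\mathbb N$ and $f\in L^1(\mathbb R)$, the Zak transform for the group $\frac1N\mathbb Z$ is $Z_N(f)(x,\xi)=\frac1N\sum_{k\in\mathbb Z} f(x+\frac kN)e^{-2\pi i\frac kN\xi}$, $x,\xi\in\mathbb R$; it extends (by density) to an isometric isomorphism from $L^2(\mathbb R)$ onto $L^2([0,1/N)\times[0,N))$, and for $f\in L^2(\mathbb R)$, $Z_N(f)$ denotes this extension (a function on $\mathbb R^2$, $N$-periodic in $\xi$ and satisfying $Z_N(f)(x+\ell/N,\xi)=e^{2\pi i\ell\xi/N}Z_N(f)(x,\xi)$ for $\ell\in\mathbb Z$). *)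

theory Defs
  imports "HOL-Analysis.Analysis"
begin

text \<open>Elements of L2(R) are represented by measurable functions real => complex
  with finite L2 norm; equality in L2 is equality almost everywhere.\<close>

definition sq_int :: "(real \<Rightarrow> complex) \<Rightarrow> bool" where
  "sq_int f \<longleftrightarrow> f \<in> borel_measurable lborel \<and>
     (\<integral>\<^sup>+ x. ennreal ((cmod (f x))\<^sup>2) \<partial>lborel) < \<infinity>"

definition l2dist2 :: "(real \<Rightarrow> complex) \<Rightarrow> (real \<Rightarrow> complex) \<Rightarrow> ennreal" where
  "l2dist2 f g = (\<integral>\<^sup>+ x. ennreal ((cmod (f x - g x))\<^sup>2) \<partial>lborel)"

definition transl :: "real \<Rightarrow> (real \<Rightarrow> complex) \<Rightarrow> (real \<Rightarrow> complex)" where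
  "transl h f = (\<lambda>x. f (x - h))"

definition int_shift_space :: "(real \<Rightarrow> complex) \<Rightarrow> (real \<Rightarrow> complex) set" where
  "int_shift_space \<psi> = {f. sq_int f \<and>
     (\<forall>\<epsilon>>0. \<exists>S c. finite (S :: int set) \<and>
        l2dist2 f (\<lambda>x. \<Sum>k\<in>S. c k * transl (of_int k) \<psi> x) < ennreal \<epsilon>)}"

definition zak_L1 :: "nat \<Rightarrow> (real \<Rightarrow> complex) \<Rightarrow> real \<times> real \<Rightarrow> complex" where
  "zak_L1 N f = (\<lambda>(x, \<xi>). complex_of_real (1 / real N) *
     (\<Sum>\<^sub>\<infinity>k\<in>(UNIV :: int set). f (x + of_int k / real N) *
        cis (- 2 * pi * (of_int k / real N) * \<xi>)))"

definition zak_dom :: "nat \<Rightarrow> (real \<times> real) set" where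
  "zak_dom N = {0..<1 / real N} \<times> {0..<real N}"

text \<open>Z is (a representative of) the extension by density of the Zak transform to psi in L2:
  Z is measurable and square integrable on the fundamental domain, and whenever
  f_n in L1 \<inter> L2 converge to psi in L2, Z_N(f_n) converge to Z in
  L2([0,1/N) x [0,N)).\<close>
definition is_zak_L2 :: "nat \<Rightarrow> (real \<Rightarrow> complex) \<Rightarrow> (real \<times> real \<Rightarrow> complex) \<Rightarrow> bool" where
  "is_zak_L2 N \<psi> Z \<longleftrightarrow> Z \<in> borel_measurable lborel \<and>
     (\<integral>\<^sup>+ t. indicator (zak_dom N) t * ennreal ((cmod (Z t))\<^sup>2) \<partial>lborel) < \<infinity> \<and>
     (\<forall>f :: nat \<Rightarrow> real \<Rightarrow> complex.
        (\<forall>n. integrable lborel (f n) \<and> sq_int (f n)) \<and>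
        (\<lambda>n. l2dist2 (f n) \<psi>) \<longlonglongrightarrow> 0 \<longrightarrow>
        (\<lambda>n. \<integral>\<^sup>+ t. indicator (zak_dom N) t *
               ennreal ((cmod (zak_L1 N (f n) t - Z t))\<^sup>2) \<partial>lborel) \<longlonglongrightarrow> 0)"

definition zakN :: "nat \<Rightarrow> (real \<Rightarrow> complex) \<Rightarrow> real \<times> real \<Rightarrow> complex" where
  "zakN N \<psi> = (SOME Z. is_zak_L2 N \<psi> Z)"

end

theory Submission
  imports Defs
begin

text \<open>
  The Zak transform turns a translation by \<open>k / N\<close> into multiplication by
  \<open>\<omega>\<^sup>k\<close> with \<open>\<omega>(\<xi>) = exp(- 2 \<pi> i \<xi> / N)\<close>, so integer translations become multiplications by
  1-periodic trigonometric polynomials. Hence invariance says that \<open>\<omega> Z\<close> is a limit of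
  products \<open>m Z\<close> with 1-periodic \<open>m\<close>. As \<open>\<omega>(\<xi> + p)\<close> differs from \<open>\<omega>(\<xi> + q)\<close> for
  \<open>p \<noteq> q\<close>, this forces the slices \<open>Z(_, \<xi> + p)\<close> and \<open>Z(_, \<xi> + q)\<close> not to be both nonzero.
  Conversely, if at most one slice is nonzero for almost every \<open>\<xi>\<close>, then \<open>\<omega>\<^sup>k\<close> agrees on the support
  of \<open>Z\<close> with a bounded 1-periodic function, which trigonometric polynomials approximate in the
  \<open>L\<^sup>2\<close> space weighted by the slice norms.
\<close>

section \<open>Square-integrable functions\<close>

text \<open>The function \<open>Z\<close> has no formula: it is known only as an \<open>L2\<close>
  limit, up to null sets. Exact identities are therefore proved for symmetric partial sums of the
  Zak series, where finite Parseval applies, and are passed to the limit afterwards. Membership in a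
  closed span is a statement about arbitrarily small errors, so bounded constant factors such as 4
  are harmless. What crosses between the two sides is a two-sided comparison: a combination of
  translates of \<open>\<psi>\<close> is small if and only if the corresponding multiplier times
  \<open>Z\<close> is small. A multiplier depends on \<open>\<xi>\<close> alone, so the norm of its
  product with \<open>Z\<close> sees \<open>Z\<close> only through the \<open>L2\<close> norms in
  \<open>x\<close> at fixed \<open>\<xi>\<close>. This reduces the question to one frequency
  variable with \<open>N\<close> weights on the unit interval. Integer translates act there by one
  and the same 1-periodic function on all \<open>N\<close> weights, while translation by
  \<open>1 / N\<close> acts by a different unimodular factor on each.\<close>

definition l2sq :: "'a measure \<Rightarrow> ('a \<Rightarrow> complex) \<Rightarrow> ennreal" where
  "l2sq M f = (\<integral>\<^sup>+ x. ennreal ((cmod (f x))\<^sup>2) \<partial>M)"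

lemma cmod_add_sq_le: "(cmod (a + b))\<^sup>2 \<le> 2 * (cmod a)\<^sup>2 + 2 * (cmod b)\<^sup>2"
proof -
  have "(cmod (a + b))\<^sup>2 \<le> (cmod a + cmod b)\<^sup>2"
    by (simp add: norm_triangle_ineq power_mono)
  also have "\<dots> \<le> 2 * (cmod a)\<^sup>2 + 2 * (cmod b)\<^sup>2"
    using sum_squares_bound[of "cmod a" "cmod b"] by (simp add: power2_sum)
  finally show ?thesis .
qed

text \<open>Working with squared norms in \<open>ennreal\<close> avoids roots and finiteness
  conditions. The price is a factor 2 in place of the triangle inequality.\<close>

lemma l2sq_add_le:
  assumes [measurable]: "f \<in> borel_measurable M" "g \<in> borel_measurable M"
  shows "l2sq M (\<lambda>x. f x + g x) \<le> 2 * l2sq M f + 2 * l2sq M g"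
proof -
  have "l2sq M (\<lambda>x. f x + g x) \<le>
      (\<integral>\<^sup>+ x. 2 * ennreal ((cmod (f x))\<^sup>2) + 2 * ennreal ((cmod (g x))\<^sup>2) \<partial>M)"
    unfolding l2sq_def
  proof (rule nn_integral_mono)
    fix x
    have "ennreal ((cmod (f x + g x))\<^sup>2) \<le> ennreal (2 * (cmod (f x))\<^sup>2 + 2 * (cmod (g x))\<^sup>2)"
      by (intro ennreal_leI cmod_add_sq_le)
    then show "ennreal ((cmod (f x + g x))\<^sup>2) \<le> 2 * ennreal ((cmod (f x))\<^sup>2) + 2 * ennreal ((cmod (g x))\<^sup>2)"
      by (simp add: ennreal_mult)
  qed
  also have "\<dots> = 2 * l2sq M f + 2 * l2sq M g"
    unfolding l2sq_def by (simp add: nn_integral_add nn_integral_cmult)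
  finally show ?thesis .
qed

lemma l2sq_diff_commute: "l2sq M (\<lambda>x. f x - g x) = l2sq M (\<lambda>x. g x - f x)"
  unfolding l2sq_def by (simp add: norm_minus_commute)

lemma l2sq_triangle:
  assumes [measurable]: "f \<in> borel_measurable M" "g \<in> borel_measurable M" "h \<in> borel_measurable M"
  shows "l2sq M (\<lambda>x. f x - h x) \<le> 2 * l2sq M (\<lambda>x. f x - g x) + 2 * l2sq M (\<lambda>x. g x - h x)"
  using l2sq_add_le[of "\<lambda>x. f x - g x" M "\<lambda>x. g x - h x"] by simp

text \<open>The factor 4 comes from using \<open>|a + b|\<^sup>2 \<le> 2|a|\<^sup>2 + 2|b|\<^sup>2\<close> twice; comparability of the
  two norms is all that is needed.\<close>

lemma l2sq_limit_le:
  assumes [measurable]: "\<And>n. h n \<in> borel_measurable M" "H \<in> borel_measurable M"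
      "\<And>n. g n \<in> borel_measurable L" "G \<in> borel_measurable L"
    and h: "(\<lambda>n. l2sq M (\<lambda>x. h n x - H x)) \<longlonglongrightarrow> 0"
    and g: "(\<lambda>n. l2sq L (\<lambda>x. g n x - G x)) \<longlonglongrightarrow> 0"
    and eq: "\<And>n. l2sq M (h n) = C * l2sq L (g n)" and C: "C < top"
  shows "l2sq M H \<le> 4 * C * l2sq L G"
proof -
  have "l2sq M H \<le> 2 * l2sq M (\<lambda>x. h n x - H x) + (4 * C * l2sq L (\<lambda>x. g n x - G x) + 4 * C * l2sq L G)" for n
  proof -
    have "l2sq M H \<le> 2 * l2sq M (\<lambda>x. h n x - H x) + 2 * (C * l2sq L (g n))"
      using l2sq_triangle[of H M "h n" "\<lambda>_. 0"] eq[of n] by (simp add: l2sq_diff_commute)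
    also have "2 * (C * l2sq L (g n)) \<le> 2 * (C * (2 * l2sq L (\<lambda>x. g n x - G x) + 2 * l2sq L G))"
      using l2sq_triangle[of "g n" L G "\<lambda>_. 0"] by (intro mult_left_mono) auto
    also have "\<dots> = (2 * 2) * C * l2sq L (\<lambda>x. g n x - G x) + (2 * 2) * C * l2sq L G"
      by (simp only: distrib_left mult_ac)
    finally show ?thesis by (simp add: add_left_mono)
  qed
  moreover have "(\<lambda>n. 2 * l2sq M (\<lambda>x. h n x - H x) + (4 * C * l2sq L (\<lambda>x. g n x - G x) + 4 * C * l2sq L G))
      \<longlonglongrightarrow> 2 * 0 + (4 * C * 0 + 4 * C * l2sq L G)"
    using C by (intro tendsto_add ennreal_tendsto_cmult h g tendsto_const) (auto simp: ennreal_mult_less_top)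
  ultimately show ?thesis
    by (intro LIMSEQ_le_const) auto
qed

text \<open>Fatou's lemma applied to the squared errors. \<open>H\<close> is replaced by a liminf of
  measurable functions almost everywhere before Fatou is applied, so no measurability of
  \<open>H\<close> is assumed; this is how the infinite series \<open>zak_L1\<close> is handled
  later.\<close>

lemma l2sq_fatou:
  assumes [measurable]: "\<And>n. h n \<in> borel_measurable M" "g \<in> borel_measurable M"
    and lim: "AE x in M. (\<lambda>n. h n x) \<longlonglongrightarrow> H x"
  shows "l2sq M (\<lambda>x. g x - H x) \<le> liminf (\<lambda>n. l2sq M (\<lambda>x. g x - h n x))"
proof -
  have "l2sq M (\<lambda>x. g x - H x) = (\<integral>\<^sup>+ x. liminf (\<lambda>n. ennreal ((cmod (g x - h n x))\<^sup>2)) \<partial>M)"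
    unfolding l2sq_def
  proof (rule nn_integral_cong_AE, use lim in eventually_elim)
    fix x assume "(\<lambda>n. h n x) \<longlonglongrightarrow> H x"
    then have "(\<lambda>n. ennreal ((cmod (g x - h n x))\<^sup>2)) \<longlonglongrightarrow> ennreal ((cmod (g x - H x))\<^sup>2)"
      by (intro tendsto_intros)
    then show "ennreal ((cmod (g x - H x))\<^sup>2) = liminf (\<lambda>n. ennreal ((cmod (g x - h n x))\<^sup>2))"
      by (rule lim_imp_Liminf[OF sequentially_bot, symmetric])
  qed
  also have "\<dots> \<le> liminf (\<lambda>n. l2sq M (\<lambda>x. g x - h n x))"
    unfolding l2sq_def by (rule nn_integral_liminf) measurable
  finally show ?thesis .
qed

text \<open>Riesz-Fischer: a rapidly Cauchy subsequence converges almost everywhere, and Fatou turns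
  its pointwise limit into an \<open>L2\<close> limit of the whole sequence.\<close>

lemma l2sq_complete:
  assumes [measurable]: "\<And>n. h n \<in> borel_measurable M"
    and cauchy: "\<And>e. e > 0 \<Longrightarrow> \<exists>K. \<forall>m\<ge>K. \<forall>n\<ge>K. l2sq M (\<lambda>x. h m x - h n x) < ennreal e"
  obtains Z where "Z \<in> borel_measurable M" "(\<lambda>n::nat. l2sq M (\<lambda>x. h n x - Z x)) \<longlonglongrightarrow> 0"
proof -
  \<comment> \<open>The rate \<open>(1/8)^j\<close> leaves room for the weight \<open>2^j\<close>
    below: the weighted errors are still bounded by the summable \<open>(1/4)^j\<close>.\<close>
  have "\<exists>K. \<forall>m\<ge>K. \<forall>n\<ge>K. l2sq M (\<lambda>x. h m x - h n x) < ennreal ((1/8)^j)" for j :: nat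
    by (rule cauchy) simp
  then obtain K where K: "\<And>j m n. m \<ge> K j \<Longrightarrow> n \<ge> K j \<Longrightarrow> l2sq M (\<lambda>x. h m x - h n x) < ennreal ((1/8)^j)"
    by metis
  \<comment> \<open>A cumulative sum, so that \<open>r j\<close> and \<open>r (Suc j)\<close> both
    lie beyond the threshold \<open>K j\<close>.\<close>
  define r where "r j = (\<Sum>i\<le>j. K i)" for j
  have rK: "r j \<ge> K i" if "i \<le> j" for i j
    unfolding r_def using that by (intro member_le_sum) auto
  define d where "d j x = h (r (Suc j)) x - h (r j) x" for j x
  have [measurable]: "d j \<in> borel_measurable M" for j
    unfolding d_def by measurable
  have sum_le: "ennreal (2^j) * l2sq M (d j) \<le> ennreal ((1/4)^j)" for j
  proof -
    have "l2sq M (d j) \<le> ennreal ((1/8)^j)"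
      unfolding d_def using K[of j "r (Suc j)" "r j"] rK by (simp add: less_imp_le)
    then have "ennreal (2^j) * l2sq M (d j) \<le> ennreal (2^j) * ennreal ((1/8)^j)"
      by (rule mult_left_mono) simp
    also have "\<dots> = ennreal ((1/4)^j)"
      by (simp add: ennreal_mult[symmetric] power_mult_distrib[symmetric])
    finally show ?thesis .
  qed
  have "(\<integral>\<^sup>+ x. (\<Sum>j. ennreal (2^j * (cmod (d j x))\<^sup>2)) \<partial>M) = (\<Sum>j. ennreal (2^j) * l2sq M (d j))"
    unfolding l2sq_def by (simp add: nn_integral_suminf ennreal_mult nn_integral_cmult)
  also have "\<dots> \<le> (\<Sum>j. ennreal ((1/4)^j))"
    by (intro suminf_le sum_le) auto
  also have "\<dots> = ennreal (\<Sum>j. (1/4)^j)"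
    by (rule suminf_ennreal2) (auto intro: summable_geometric)
  also have "\<dots> < \<infinity>" by simp
  finally have "AE x in M. (\<Sum>j. ennreal (2^j * (cmod (d j x))\<^sup>2)) \<noteq> \<infinity>"
    by (intro nn_integral_PInf_AE) auto
  then have conv: "AE x in M. (\<lambda>j. h (r j) x) \<longlonglongrightarrow> lim (\<lambda>j. h (r j) x)"
  proof eventually_elim
    fix x assume "(\<Sum>j. ennreal (2^j * (cmod (d j x))\<^sup>2)) \<noteq> \<infinity>"
    then have s: "summable (\<lambda>j. 2^j * (cmod (d j x))\<^sup>2)"
      by (intro summable_suminf_not_top) auto
    \<comment> \<open>The arithmetic-geometric mean inequality with weight \<open>2^j\<close> bounds
      the increments themselves by summable terms; only their squares are controlled by the
      integrals.\<close>
    have le: "cmod (d j x) \<le> 2^j * (cmod (d j x))\<^sup>2 + (1/2)^j" for j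
    proof -
      have "0 \<le> 2^j * (cmod (d j x) - (1/2)^j)\<^sup>2" by simp
      also have "\<dots> = 2^j * (cmod (d j x))\<^sup>2 - 2 * cmod (d j x) + (1/2)^j"
        by (simp add: power2_diff algebra_simps power_divide power2_eq_square)
      finally show ?thesis
        using norm_ge_zero[of "d j x"] zero_le_power[of "1/2::real" j] mult_nonneg_nonneg[of "2^j" "(cmod (d j x))\<^sup>2"]
        by linarith
    qed
    have "summable (\<lambda>j. d j x)"
      by (rule summable_comparison_test[OF _ summable_add[OF s summable_geometric[of "1/2"]]])
        (use le in auto)
    then have "(\<lambda>n. \<Sum>j<n. d j x) \<longlonglongrightarrow> (\<Sum>j. d j x)"
      by (rule summable_LIMSEQ)
    then have "(\<lambda>n. h (r n) x - h (r 0) x) \<longlonglongrightarrow> (\<Sum>j. d j x)"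
      unfolding d_def sum_lessThan_telescope[of "\<lambda>j. h (r j) x"] .
    then have "convergent (\<lambda>n. h (r n) x - h (r 0) x)" by (rule convergentI)
    then have "convergent (\<lambda>n. h (r n) x)"
      by (simp add: convergent_diff_const_right_iff)
    then show "(\<lambda>j. h (r j) x) \<longlonglongrightarrow> lim (\<lambda>j. h (r j) x)"
      by (simp add: convergent_LIMSEQ_iff)
  qed
  define Z where "Z x = lim (\<lambda>j. h (r j) x)" for x
  have [measurable]: "Z \<in> borel_measurable M"
    unfolding Z_def by measurable
  \<comment> \<open>Only the second index runs along the subsequence; the first stays arbitrary,
    which gives convergence of the full sequence.\<close>
  have le: "l2sq M (\<lambda>x. h m x - Z x) \<le> ennreal ((1/8)^i)" if "m \<ge> K i" for m i
  proof -
    have "l2sq M (\<lambda>x. h m x - Z x) \<le> liminf (\<lambda>n. l2sq M (\<lambda>x. h m x - h (r n) x))"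
      by (rule l2sq_fatou) (use conv in \<open>auto simp: Z_def\<close>)
    also have "\<dots> \<le> liminf (\<lambda>n. ennreal ((1/8)^i))"
      by (intro Liminf_mono eventually_sequentiallyI[of i]) (use K that rK less_imp_le in blast)
    finally show ?thesis by (simp add: Liminf_const)
  qed
  have "(\<lambda>n::nat. l2sq M (\<lambda>x. h n x - Z x)) \<longlonglongrightarrow> 0"
  proof (rule order_tendstoI)
    fix a :: ennreal assume "0 < a"
    have "(\<lambda>i. ennreal ((1/8)^i)) \<longlonglongrightarrow> ennreal 0"
      by (intro tendsto_ennrealI LIMSEQ_power_zero) simp
    from order_tendstoD(2)[OF this, of a] \<open>0 < a\<close> obtain i where "ennreal ((1/8)^i) < a"
      by (auto simp: eventually_sequentially)
    then show "eventually (\<lambda>n. l2sq M (\<lambda>x. h n x - Z x) < a) sequentially"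
      using le by (intro eventually_sequentiallyI[of "K i"]) (meson le_less_trans)
  qed simp
  with \<open>Z \<in> borel_measurable M\<close> show thesis by (rule that)
qed

section \<open>Density of trigonometric polynomials\<close>

text \<open>The sign in the exponent is that of the Zak kernel, so the coefficients are directly
  those of a combination of integer translates.\<close>

definition trig_poly :: "(real \<Rightarrow> complex) \<Rightarrow> bool" where
  "trig_poly h \<longleftrightarrow>
     (\<exists>S c. finite (S :: int set) \<and> h = (\<lambda>x. \<Sum>k\<in>S. c k * cis (- 2 * pi * of_int k * x)))"

lemma trig_poly_monomial: "trig_poly (\<lambda>x. a * cis (- 2 * pi * of_int k * x))"
  unfolding trig_poly_def by (intro exI[of _ "{k}"] exI[of _ "\<lambda>_. a"]) auto

lemma trig_poly_const: "trig_poly (\<lambda>x. a)"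
  using trig_poly_monomial[of a 0] by simp

lemma trig_poly_add:
  assumes "trig_poly f" "trig_poly g"
  shows "trig_poly (\<lambda>x. f x + g x)"
proof -
  obtain S c where S: "finite S" "f = (\<lambda>x. \<Sum>k\<in>S. c k * cis (- 2 * pi * of_int k * x))"
    using assms(1) unfolding trig_poly_def by blast
  obtain T d where T: "finite T" "g = (\<lambda>x. \<Sum>k\<in>T. d k * cis (- 2 * pi * of_int k * x))"
    using assms(2) unfolding trig_poly_def by blast
  let ?b = "\<lambda>k. (if k \<in> S then c k else 0) + (if k \<in> T then d k else 0)"
  have "f x + g x = (\<Sum>k\<in>S \<union> T. ?b k * cis (- 2 * pi * of_int k * x))" for x
  proof -
    have "f x = (\<Sum>k\<in>S \<union> T. (if k \<in> S then c k else 0) * cis (- 2 * pi * of_int k * x))"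
      unfolding S(2) using S(1) T(1) by (intro sum.mono_neutral_cong_left) auto
    moreover have "g x = (\<Sum>k\<in>S \<union> T. (if k \<in> T then d k else 0) * cis (- 2 * pi * of_int k * x))"
      unfolding T(2) using S(1) T(1) by (intro sum.mono_neutral_cong_left) auto
    ultimately show ?thesis by (simp add: sum.distrib distrib_right)
  qed
  then show ?thesis
    unfolding trig_poly_def using S(1) T(1) by (intro exI[of _ "S \<union> T"] exI[of _ ?b]) auto
qed

lemma trig_poly_sum:
  assumes "finite I" "\<And>i. i \<in> I \<Longrightarrow> trig_poly (f i)"
  shows "trig_poly (\<lambda>x. \<Sum>i\<in>I. f i x)"
  using assms by (induction I rule: finite_induct) (auto intro: trig_poly_const trig_poly_add)

lemma trig_poly_mult:
  assumes "trig_poly f" "trig_poly g"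
  shows "trig_poly (\<lambda>x. f x * g x)"
proof -
  obtain S c where S: "finite S" "f = (\<lambda>x. \<Sum>k\<in>S. c k * cis (- 2 * pi * of_int k * x))"
    using assms(1) unfolding trig_poly_def by blast
  obtain T d where T: "finite T" "g = (\<lambda>x. \<Sum>k\<in>T. d k * cis (- 2 * pi * of_int k * x))"
    using assms(2) unfolding trig_poly_def by blast
  have "f x * g x = (\<Sum>k\<in>S. \<Sum>l\<in>T. (c k * d l) * cis (- 2 * pi * of_int (k + l) * x))" for x
    unfolding S(2) T(2) sum_product
    by (intro sum.cong refl) (simp add: cis_mult algebra_simps)
  then show ?thesis
    using S(1) T(1) by (simp only: trig_poly_sum trig_poly_monomial)
qed

text \<open>Stone-Weierstrass yields polynomials in the real coordinates of the circle. By Euler's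
  formula each real linear form on the circle is a combination of the frequencies 1 and -1, and sums
  and products preserve trigonometric polynomials.\<close>

lemma trig_poly_real_polynomial_function:
  fixes g :: "complex \<Rightarrow> real"
  assumes "real_polynomial_function g"
  shows "trig_poly (\<lambda>x. of_real (g (cis (2 * pi * x))))"
  using assms
proof (induction rule: real_polynomial_function.induct)
  case (linear f)
  interpret bounded_linear f by fact
  have "complex_of_real (f (cis t)) = (of_real (f 1) - \<i> * of_real (f \<i>)) / 2 * cis t
      + (of_real (f 1) + \<i> * of_real (f \<i>)) / 2 * cis (- t)" for t
  proof -
    have "f (cis t) = f (cos t *\<^sub>R 1 + sin t *\<^sub>R \<i>)"
      by (rule arg_cong[of _ _ f]) (simp add: complex_eq_iff)
    also have "\<dots> = cos t * f 1 + sin t * f \<i>"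
      by (simp only: add scaleR) simp
    finally show ?thesis by (simp add: complex_eq_iff field_simps)
  qed
  then have "complex_of_real (f (cis (2 * pi * x))) =
      (of_real (f 1) - \<i> * of_real (f \<i>)) / 2 * cis (- 2 * pi * of_int (-1) * x)
      + (of_real (f 1) + \<i> * of_real (f \<i>)) / 2 * cis (- 2 * pi * of_int 1 * x)" for x
    by simp
  then show ?case by (simp only: trig_poly_add trig_poly_monomial)
qed (simp_all add: trig_poly_const trig_poly_add trig_poly_mult)

lemma trig_poly_uniform_approx:
  fixes h :: "real \<Rightarrow> complex"
  assumes "continuous_on {0..1} h" "h 0 = h 1" "e > 0"
  obtains P where "trig_poly P" "\<And>x. x \<in> {0..<1} \<Longrightarrow> cmod (h x - P x) < e"
proof -
  let ?H = "h \<circ> (\<lambda>z. Arg2pi z / (2 * pi))"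
  \<comment> \<open>The trivial homotopy from the loop \<open>h\<close> to itself serves to transfer
    continuity: wrapped around the circle by \<open>Arg2pi\<close>, \<open>h\<close> is continuous
    even at the point 1, because its end values agree.\<close>
  have "homotopic_loops UNIV h h"
    using assms by (simp add: homotopic_loops_refl path_def pathfinish_def pathstart_def)
  from homotopic_with_imp_continuous[OF homotopic_loops_imp_homotopic_circlemaps[OF this]]
  have "continuous_on (sphere 0 1) ?H" by simp
  then obtain g where g: "polynomial_function g" "\<And>z. z \<in> sphere 0 1 \<Longrightarrow> norm (?H z - g z) < e"
    using Stone_Weierstrass_polynomial_function[of "sphere 0 1" ?H e] \<open>e > 0\<close> by auto
  show thesis
  proof (rule that)
    have "real_polynomial_function (\<lambda>z. Re (g z))" "real_polynomial_function (\<lambda>z. Im (g z))"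
      using g(1) bounded_linear_Re bounded_linear_Im
      unfolding polynomial_function_def o_def by auto
    then have "trig_poly (\<lambda>x. of_real (Re (g (cis (2 * pi * x)))) + \<i> * of_real (Im (g (cis (2 * pi * x)))))"
      by (intro trig_poly_add trig_poly_mult trig_poly_const trig_poly_real_polynomial_function)
    then show "trig_poly (\<lambda>x. g (cis (2 * pi * x)))"
      by (simp add: complex_eq[symmetric])
    fix x :: real assume x: "x \<in> {0..<1}"
    then have "Arg2pi (cis (2 * pi * x)) = 2 * pi * x"
      by (intro Arg2pi_unique[of 1]) (auto simp: cis_conv_exp)
    then show "cmod (h x - g (cis (2 * pi * x))) < e"
      using g(2)[of "cis (2 * pi * x)"] by simp
  qed
qed

text \<open>This is the radial retraction onto the ball of radius \<open>B\<close>. The denominator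
  is at least \<open>B > 0\<close>, so composing with it keeps continuity.\<close>

lemma clamp_norm:
  fixes z :: complex
  assumes "B > 0"
  shows "norm ((B / max B (norm z)) *\<^sub>R z) \<le> B" "norm z \<le> B \<Longrightarrow> (B / max B (norm z)) *\<^sub>R z = z"
  using assms by (auto simp: max_def field_simps)

text \<open>Continuous functions converging almost everywhere to \<open>m\<close> are clamped, so that dominated
  convergence applies, and cut off at the end points of the unit interval, so that they become periodic.\<close>

lemma trig_poly_dense:
  fixes m :: "real \<Rightarrow> complex" and W :: "real \<Rightarrow> ennreal"
  assumes m [measurable]: "m \<in> borel_measurable borel" and bdd: "\<And>x. cmod (m x) \<le> B"
    and W [measurable]: "W \<in> borel_measurable borel"
    and fin: "(\<integral>\<^sup>+ x. W x * indicator {0..<1} x \<partial>lborel) < \<infinity>" and "e > 0"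
  obtains P where "trig_poly P"
    "(\<integral>\<^sup>+ x. ennreal ((cmod (m x - P x))\<^sup>2) * W x * indicator {0..<1} x \<partial>lborel) < e"
proof -
  \<comment> \<open>The bound \<open>B\<close> may be 0, whereas clamping needs a positive
    radius.\<close>
  define C where "C = max B 1"
  have C: "C > 0" "\<And>x. cmod (m x) \<le> C"
    using bdd by (auto simp: C_def intro: le_max_iff_disj[THEN iffD2])
  have "m \<in> borel_measurable lebesgue"
    using m by (simp add: measurable_completion)
  then have "m measurable_on UNIV"
    by (simp add: measurable_on_iff_borel_measurable)
  then obtain E g where E: "negligible E" and g: "\<And>n. continuous_on UNIV (g n)"
      and lim: "\<And>x. x \<notin> E \<Longrightarrow> (\<lambda>n. g n x) \<longlonglongrightarrow> m x"
    unfolding measurable_on_def by auto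
  define cut :: "nat \<Rightarrow> real \<Rightarrow> real" where "cut n x = max 0 (min 1 (real n * (x * (1 - x))))" for n x
  define h where "h n x = cut n x *\<^sub>R ((C / max C (norm (g n x))) *\<^sub>R g n x)" for n x
  have cont: "continuous_on A (h n)" for n A
    unfolding h_def cut_def using C(1)
    by (intro continuous_intros continuous_on_subset[OF g]) auto
  then have [measurable]: "h n \<in> borel_measurable borel" for n
    by (rule borel_measurable_continuous_onI)
  have hC: "cmod (h n x) \<le> C" for n x
  proof -
    have "cmod (h n x) \<le> 1 * C"
      unfolding h_def norm_scaleR[of "cut n x"] by (intro mult_mono clamp_norm C) (auto simp: cut_def)
    then show ?thesis by simp
  qed
  have h_lim: "(\<lambda>n. h n x) \<longlonglongrightarrow> m x" if "x \<notin> E" "x \<in> {0<..<1}" for x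
  proof -
    have "(\<lambda>n. (C / max C (norm (g n x))) *\<^sub>R g n x) \<longlonglongrightarrow> (C / max C (norm (m x))) *\<^sub>R m x"
      using C(1) by (intro tendsto_intros lim that) auto
    then have "(\<lambda>n. (C / max C (norm (g n x))) *\<^sub>R g n x) \<longlonglongrightarrow> m x"
      using clamp_norm(2)[OF C(1) C(2)] by simp
    moreover have "(\<lambda>n. cut n x) \<longlonglongrightarrow> 1"
    proof (rule tendsto_eventually)
      have pos: "x * (1 - x) > 0" using that by simp
      obtain k :: nat where k: "real k * (x * (1 - x)) > 1"
        using reals_Archimedean3[OF pos] by blast
      show "eventually (\<lambda>n. cut n x = 1) sequentially"
      proof (rule eventually_sequentiallyI[of k])
        fix n assume "k \<le> n"
        then have "real k * (x * (1 - x)) \<le> real n * (x * (1 - x))"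
          using pos by (intro mult_right_mono) auto
        then show "cut n x = 1" using k by (simp add: cut_def)
      qed
    qed
    ultimately have "(\<lambda>n. cut n x *\<^sub>R ((C / max C (norm (g n x))) *\<^sub>R g n x)) \<longlonglongrightarrow> 1 *\<^sub>R m x"
      by (intro tendsto_scaleR)
    then show ?thesis by (simp add: h_def)
  qed
  let ?I = "\<lambda>f. (\<integral>\<^sup>+ x. ennreal ((cmod (f x))\<^sup>2) * (W x * indicator {0..<1} x) \<partial>lborel)"
  have AE_E: "AE x in lborel. x \<notin> E"
    using AE_not_in[of E lebesgue] E by (simp add: negligible_iff_null_sets AE_completion_iff)
  have AE_0: "AE x in lborel. x \<noteq> (0::real)"
    by (rule AE_lborel_singleton)
  \<comment> \<open>Where the weight is infinite, a pointwise limit 0 would not survive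
    multiplication by it; such points form a null set within the unit interval.\<close>
  have AE_W: "AE x in lborel. W x * indicator {0..<1} x \<noteq> \<infinity>"
    using fin by (intro nn_integral_PInf_AE) auto
  have "(\<lambda>n. ?I (\<lambda>x. m x - h n x)) \<longlonglongrightarrow> (\<integral>\<^sup>+ (x::real). 0 \<partial>lborel)"
  proof (rule nn_integral_dominated_convergence)
    show "AE x in lborel. ennreal ((cmod (m x - h n x))\<^sup>2) * (W x * indicator {0..<1} x)
        \<le> ennreal ((2 * C)\<^sup>2) * (W x * indicator {0..<1} x)" for n
    proof (intro AE_I2 mult_right_mono ennreal_leI power_mono)
      show "cmod (m x - h n x) \<le> 2 * C" for x
        using norm_triangle_ineq4[of "m x" "h n x"] C(2)[of x] hC[of n x] by linarith
    qed auto
    show "(\<integral>\<^sup>+ x. ennreal ((2 * C)\<^sup>2) * (W x * indicator {0..<1} x) \<partial>lborel) < \<infinity>"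
      using fin by (subst nn_integral_cmult) (auto simp: ennreal_mult_less_top)
    show "AE x in lborel. (\<lambda>n. ennreal ((cmod (m x - h n x))\<^sup>2) * (W x * indicator {0..<1} x)) \<longlonglongrightarrow> 0"
      using AE_E AE_0 AE_W
    proof eventually_elim
      case (elim x)
      show ?case
      proof (cases "x \<in> {0<..<1}")
        case True
        have "(\<lambda>n. ennreal ((cmod (m x - h n x))\<^sup>2)) \<longlonglongrightarrow> ennreal ((cmod (m x - m x))\<^sup>2)"
          by (intro tendsto_intros h_lim True elim)
        from ennreal_tendsto_cmult[OF _ this, of "W x * indicator {0..<1} x"] elim(3)
        show ?thesis by (simp add: mult.commute less_top)
      qed (use elim in \<open>auto simp: indicator_def\<close>)
    qed
  qed measurable
  then have lim0: "(\<lambda>n. ?I (\<lambda>x. m x - h n x)) \<longlonglongrightarrow> 0" by simp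
  define w where "w = (\<integral>\<^sup>+ x. W x * indicator {0..<1} x \<partial>lborel)"
  \<comment> \<open>The tolerance \<open>e\<close> may be infinite, so a finite positive
    \<open>e'\<close> below it is fixed.\<close>
  obtain z where z: "0 < z" "z < e"
    using dense[OF \<open>e > 0\<close>] by blast
  obtain e' where "e' \<ge> 0" "z = ennreal e'"
    using z(2) by (cases z) auto
  with z have e': "e' > 0" "ennreal e' < e" by auto
  have "eventually (\<lambda>n. ?I (\<lambda>x. m x - h n x) < ennreal (e' / 4)) sequentially"
    using e' by (intro order_tendstoD(2)[OF lim0]) auto
  then obtain n where n: "?I (\<lambda>x. m x - h n x) < ennreal (e' / 4)"
    by (auto simp: eventually_sequentially)
  define w' where "w' = enn2real w"
  have w': "w = ennreal w'" "w' \<ge> 0"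
    using fin unfolding w'_def w_def by (auto simp: less_top)
  \<comment> \<open>Chosen so that \<open>2 * d\<^sup>2 * w'\<close> is at most
    \<open>e' / 2\<close>; the other half of \<open>e'\<close> is spent on replacing
    \<open>m\<close> by \<open>h n\<close>. The summand 1 guards against a vanishing total
    weight.\<close>
  define d where "d = sqrt (e' / (4 * (w' + 1)))"
  have d: "d > 0" "d\<^sup>2 = e' / (4 * (w' + 1))"
    using e' w' by (auto simp: d_def)
  have "h n 0 = h n 1" by (simp add: h_def cut_def)
  then obtain P where P: "trig_poly P" "\<And>x. x \<in> {0..<1} \<Longrightarrow> cmod (h n x - P x) < d"
    using trig_poly_uniform_approx[OF cont _ d(1)] by metis
  have [measurable]: "P \<in> borel_measurable borel"
    using P(1) unfolding trig_poly_def
    by (auto intro!: borel_measurable_continuous_onI continuous_intros)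
  have "?I (\<lambda>x. m x - P x) \<le> (\<integral>\<^sup>+ x. 2 * (ennreal ((cmod (m x - h n x))\<^sup>2) * (W x * indicator {0..<1} x))
        + ennreal (2 * d\<^sup>2) * (W x * indicator {0..<1} x) \<partial>lborel)"
  proof (rule nn_integral_mono)
    fix x :: real
    show "ennreal ((cmod (m x - P x))\<^sup>2) * (W x * indicator {0..<1} x) \<le>
        2 * (ennreal ((cmod (m x - h n x))\<^sup>2) * (W x * indicator {0..<1} x))
        + ennreal (2 * d\<^sup>2) * (W x * indicator {0..<1} x)"
    proof (cases "x \<in> {0..<1}")
      case True
      have "(cmod (h n x - P x))\<^sup>2 \<le> d\<^sup>2"
        using P(2)[OF True] by (intro power_mono) auto
      then have "(cmod (m x - P x))\<^sup>2 \<le> 2 * (cmod (m x - h n x))\<^sup>2 + 2 * d\<^sup>2"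
        using cmod_add_sq_le[of "m x - h n x" "h n x - P x"] by simp
      then have "ennreal ((cmod (m x - P x))\<^sup>2) \<le> ennreal (2 * (cmod (m x - h n x))\<^sup>2 + 2 * d\<^sup>2)"
        by (rule ennreal_leI)
      also have "\<dots> = 2 * ennreal ((cmod (m x - h n x))\<^sup>2) + ennreal (2 * d\<^sup>2)"
        by (simp add: ennreal_mult)
      finally have "ennreal ((cmod (m x - P x))\<^sup>2) \<le> 2 * ennreal ((cmod (m x - h n x))\<^sup>2) + ennreal (2 * d\<^sup>2)" .
      then have "ennreal ((cmod (m x - P x))\<^sup>2) * (W x * indicator {0..<1} x) \<le>
         (2 * ennreal ((cmod (m x - h n x))\<^sup>2) + ennreal (2 * d\<^sup>2)) * (W x * indicator {0..<1} x)"
        by (rule mult_right_mono) simp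
      then show ?thesis by (simp only: distrib_right mult.assoc)
    qed simp
  qed
  also have "\<dots> = 2 * ?I (\<lambda>x. m x - h n x) + ennreal (2 * d\<^sup>2) * w"
    by (simp add: nn_integral_add nn_integral_cmult w_def)
  also have "\<dots> \<le> 2 * ennreal (e' / 4) + ennreal (2 * d\<^sup>2) * ennreal w'"
    using n w' by (intro add_mono mult_left_mono) auto
  also have "\<dots> = ennreal (2 * (e' / 4) + 2 * d\<^sup>2 * w')"
    using e' w' ennreal_mult'[of 2 "e' / 4"] by (simp add: ennreal_mult)
  also have "\<dots> \<le> ennreal e'"
  proof (rule ennreal_leI)
    have "w' / (w' + 1) \<le> 1" using w' by simp
    then have "e' * (w' / (w' + 1)) \<le> e' * 1" using e' by (intro mult_left_mono) auto
    then show "2 * (e' / 4) + 2 * d\<^sup>2 * w' \<le> e'" unfolding d(2) using w' by (simp add: field_simps)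
  qed
  also note e'(2)
  finally show thesis by (intro that[OF P(1)]) (simp add: mult.assoc)
qed

section \<open>Partial sums of the Zak transform\<close>

abbreviation zak_measure :: "nat \<Rightarrow> (real \<times> real) measure" where
  "zak_measure N \<equiv> restrict_space lborel (zak_dom N)"

lemma sets_zak_dom [measurable, simp]: "zak_dom N \<in> sets borel"
  unfolding zak_dom_def by (simp add: borel_prod[symmetric])

lemma measurable_zak_measure:
  "f \<in> borel_measurable borel \<Longrightarrow> f \<in> borel_measurable (zak_measure N)"
  by (simp add: measurable_restrict_space1)

lemma l2sq_zak_measure:
  "l2sq (zak_measure N) F = (\<integral>\<^sup>+ t. indicator (zak_dom N) t * ennreal ((cmod (F t))\<^sup>2) \<partial>lborel)"
  unfolding l2sq_def by (subst nn_integral_restrict_space) (auto simp: mult.commute)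

text \<open>Tonelli in both orders: integrating first in \<open>\<xi>\<close> prepares Parseval,
  integrating first in \<open>x\<close> produces the norms of the frequency slices.\<close>

lemma nn_integral_zak_measure:
  assumes "G \<in> borel_measurable borel"
  shows "nn_integral (zak_measure N) G =
      (\<integral>\<^sup>+ x. (\<integral>\<^sup>+ \<xi>. G (x, \<xi>) * indicator {0..<real N} \<xi> \<partial>lborel) * indicator {0..<1 / real N} x \<partial>lborel)"
    and "nn_integral (zak_measure N) G =
      (\<integral>\<^sup>+ \<xi>. (\<integral>\<^sup>+ x. G (x, \<xi>) * indicator {0..<1 / real N} x \<partial>lborel) * indicator {0..<real N} \<xi> \<partial>lborel)"
proof -
  have [measurable]: "G \<in> borel_measurable (borel \<Otimes>\<^sub>M borel)"
    using assms by (simp add: borel_prod)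
  let ?G = "\<lambda>(x, \<xi>). G (x, \<xi>) * indicator {0..<1 / real N} x * indicator {0..<real N} \<xi>"
  have eq: "nn_integral (zak_measure N) G = integral\<^sup>N (lborel \<Otimes>\<^sub>M lborel) ?G"
    unfolding lborel_prod
    by (subst nn_integral_restrict_space, simp)
      (auto intro!: nn_integral_cong simp: zak_dom_def indicator_def split: prod.splits)
  show "nn_integral (zak_measure N) G =
      (\<integral>\<^sup>+ x. (\<integral>\<^sup>+ \<xi>. G (x, \<xi>) * indicator {0..<real N} \<xi> \<partial>lborel) * indicator {0..<1 / real N} x \<partial>lborel)"
    unfolding eq by (subst lborel.nn_integral_fst[symmetric])
      (auto simp: nn_integral_cmult[symmetric] mult_ac intro!: nn_integral_cong)
  show "nn_integral (zak_measure N) G =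
      (\<integral>\<^sup>+ \<xi>. (\<integral>\<^sup>+ x. G (x, \<xi>) * indicator {0..<1 / real N} x \<partial>lborel) * indicator {0..<real N} \<xi> \<partial>lborel)"
    unfolding eq by (subst lborel_pair.nn_integral_snd[symmetric])
      (auto simp: nn_integral_cmult[symmetric] mult_ac intro!: nn_integral_cong)
qed

lemma has_integral_cis_period:
  fixes N :: nat and m :: int
  assumes "N > 0"
  shows "((\<lambda>x. cis (- 2 * pi * (of_int m / real N) * x)) has_integral (if m = 0 then of_nat N else 0)) {0..real N}"
proof (cases "m = 0")
  case True
  then show ?thesis
    using has_integral_const_real[of "1::complex" 0 "real N"] by (simp add: scaleR_conv_of_real)
next
  case False
  define c where "c = - 2 * pi * (of_int m / real N)"
  have c: "c \<noteq> 0" using False assms by (simp add: c_def)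
  have "((\<lambda>x. cis (c * x)) has_integral (cis (c * real N) / (\<i> * c) - cis (c * 0) / (\<i> * c))) {0..real N}"
  proof (rule fundamental_theorem_of_calculus)
    show "((\<lambda>x. cis (c * x) / (\<i> * c)) has_vector_derivative cis (c * x)) (at x within {0..real N})" for x
      using c unfolding has_vector_derivative_def
      by (auto intro!: derivative_eq_intros simp: scaleR_conv_of_real field_simps)
  qed simp
  moreover have "cis (c * real N) = 1"
    using assms cis_multiple_2pi[of "of_int (-m)"] by (simp add: c_def mult_ac)
  ultimately show ?thesis using False by (simp add: c_def)
qed

text \<open>In the expanded square only the diagonal terms survive integration over a full period,
  each contributing the period length \<open>N\<close>.\<close>

lemma parseval_finite:
  fixes N :: nat and S :: "int set"
  assumes "N > 0" "finite S"
  shows "(\<integral>\<^sup>+ x. ennreal ((cmod (\<Sum>k\<in>S. a k * cis (- 2 * pi * (of_int k / real N) * x)))\<^sup>2)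
      * indicator {0..<real N} x \<partial>lborel) = ennreal (real N * (\<Sum>k\<in>S. (cmod (a k))\<^sup>2))"
proof -
  define f where "f x = (\<Sum>k\<in>S. a k * cis (- 2 * pi * (of_int k / real N) * x))" for x
  have "complex_of_real ((cmod (f x))\<^sup>2) =
      (\<Sum>k\<in>S. \<Sum>l\<in>S. a k * cnj (a l) * cis (- 2 * pi * (of_int (k - l) / real N) * x))" for x
  proof -
    have split: "cis (- 2 * pi * (of_int (k - l) / real N) * x) =
        cis (- 2 * pi * (of_int k / real N) * x) * cis (- (- 2 * pi * (of_int l / real N) * x))" for k l
      unfolding cis_mult by (rule arg_cong[of _ _ cis]) (simp add: diff_divide_distrib ring_distribs)
    show ?thesis
      unfolding complex_norm_square f_def cnj_sum sum_product complex_cnj_mult cis_cnj split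
      by (simp only: mult_ac)
  qed
  moreover have "((\<lambda>x. \<Sum>k\<in>S. \<Sum>l\<in>S. a k * cnj (a l) * cis (- 2 * pi * (of_int (k - l) / real N) * x))
      has_integral (\<Sum>k\<in>S. \<Sum>l\<in>S. a k * cnj (a l) * (if k - l = 0 then of_nat N else 0))) {0..real N}"
    using assms by (intro has_integral_sum has_integral_mult_right has_integral_cis_period)
  moreover have "(\<Sum>k\<in>S. \<Sum>l\<in>S. a k * cnj (a l) * (if k - l = 0 then of_nat N else 0)) =
      complex_of_real (real N * (\<Sum>k\<in>S. (cmod (a k))\<^sup>2))"
  proof -
    have "(\<Sum>l\<in>S. a k * cnj (a l) * (if k - l = 0 then of_nat N else 0)) = of_nat N * of_real ((cmod (a k))\<^sup>2)"
      if "k \<in> S" for k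
    proof -
      have "(\<Sum>l\<in>S. a k * cnj (a l) * (if k - l = 0 then of_nat N else 0)) =
         (\<Sum>l\<in>S. if k = l then a k * cnj (a l) * of_nat N else 0)"
        by (intro sum.cong) auto
      also have "\<dots> = a k * cnj (a k) * of_nat N"
        using that assms(2) by simp
      finally show ?thesis by (simp only: complex_norm_square mult_ac)
    qed
    then show ?thesis by (simp add: sum_distrib_left)
  qed
  ultimately have "((\<lambda>x. complex_of_real ((cmod (f x))\<^sup>2)) has_integral complex_of_real (real N * (\<Sum>k\<in>S. (cmod (a k))\<^sup>2))) {0..real N}"
    by simp
  from has_integral_linear[OF this bounded_linear_Re]
  have int: "((\<lambda>x. (cmod (f x))\<^sup>2) has_integral (real N * (\<Sum>k\<in>S. (cmod (a k))\<^sup>2))) {0..real N}"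
    by (simp add: o_def del: of_real_mult of_real_power of_real_sum)
  have [measurable]: "f \<in> borel_measurable borel"
    unfolding f_def by (intro borel_measurable_continuous_onI continuous_intros)
  have "(\<integral>\<^sup>+ x. ennreal ((cmod (f x))\<^sup>2) * indicator {0..<real N} x \<partial>lborel) =
      (\<integral>\<^sup>+ x. ennreal (indicator {0..real N} x * (cmod (f x))\<^sup>2) \<partial>lborel)"
    by (rule nn_integral_cong_AE, use AE_lborel_singleton[of "real N"] in eventually_elim)
      (auto simp: indicator_def)
  also have "\<dots> = ennreal (real N * (\<Sum>k\<in>S. (cmod (a k))\<^sup>2))"
  proof (rule nn_integral_has_integral_lborel)
    show "((\<lambda>x. indicator {0..real N} x * (cmod (f x))\<^sup>2) has_integral real N * (\<Sum>k\<in>S. (cmod (a k))\<^sup>2)) UNIV"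
      using int has_integral_restrict_UNIV[of "{0..real N}" "\<lambda>x. (cmod (f x))\<^sup>2"]
      by (simp add: indicator_def of_bool_def if_distrib[of "\<lambda>z. z * _"] cong: if_cong)
  qed (auto intro: sum_nonneg)
  finally show ?thesis unfolding f_def .
qed

text \<open>Half-open on purpose: it is tiled exactly by the cells \<open>{0..<1 / real N}\<close>
  shifted by \<open>k / N\<close> with \<open>- n \<le> k < n\<close>, so no point is missed or
  counted twice.\<close>

definition trunc_interval :: "nat \<Rightarrow> nat \<Rightarrow> real set" where
  "trunc_interval N n = {- (real n / real N)..<real n / real N}"

lemma trunc_interval_iff:
  assumes "N > 0" "x \<in> {0..<1 / real N}"
  shows "x + of_int k / real N \<in> trunc_interval N n \<longleftrightarrow> k \<in> {- int n..<int n}"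
proof -
  have eq: "x + of_int k / real N = (real N * x + of_int k) / real N"
    using assms(1) by (simp add: field_simps)
  have "- (real n / real N) \<le> x + of_int k / real N \<longleftrightarrow> real_of_int (- int n - k) \<le> real N * x"
    using assms(1) divide_le_cancel[of "- real n" "real N" "real N * x + of_int k"] unfolding eq by auto
  also have "\<dots> \<longleftrightarrow> - int n \<le> k"
  proof
    assume "real_of_int (- int n - k) \<le> real N * x"
    also have "real N * x < 1" using assms by (simp add: field_simps)
    finally show "- int n \<le> k" by linarith
  next
    assume "- int n \<le> k"
    then have "real_of_int (- int n - k) \<le> 0" by simp
    also have "0 \<le> real N * x" using assms by simp
    finally show "real_of_int (- int n - k) \<le> real N * x" .
  qed
  finally have 1: "- (real n / real N) \<le> x + of_int k / real N \<longleftrightarrow> - int n \<le> k" .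
  have "x + of_int k / real N < real n / real N \<longleftrightarrow> real N * x < real_of_int (int n - k)"
    using assms(1) unfolding eq by (auto simp: divide_less_cancel)
  also have "\<dots> \<longleftrightarrow> k < int n"
  proof
    assume "real N * x < real_of_int (int n - k)"
    moreover have "0 \<le> real N * x" using assms by simp
    ultimately show "k < int n" by linarith
  next
    assume "k < int n"
    then have "1 \<le> real_of_int (int n - k)" by linarith
    moreover have "real N * x < 1" using assms by (simp add: field_simps)
    ultimately show "real N * x < real_of_int (int n - k)" by linarith
  qed
  finally show ?thesis using 1 by (simp add: trunc_interval_def)
qed

text \<open>A point \<open>x\<close> lies in exactly one cell of width \<open>1 / N\<close>, the one
  with index \<open>\<lfloor>real N * x\<rfloor>\<close>.\<close>

lemma sum_indicator_shift:
  assumes "N > 0"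
  shows "(\<Sum>k\<in>{- int n..<int n}. indicator {0..<1 / real N} (x - of_int k / real N)) =
    (indicator (trunc_interval N n) x :: ennreal)"
proof -
  have *: "x - of_int k / real N \<in> {0..<1 / real N} \<longleftrightarrow> k = \<lfloor>real N * x\<rfloor>" for k
  proof -
    have "x - of_int k / real N = (real N * x - of_int k) / real N"
      using assms by (simp add: field_simps)
    then show ?thesis
      using assms by (auto simp: divide_less_cancel zero_le_divide_iff intro!: floor_unique[symmetric]) linarith+
  qed
  have "x \<in> trunc_interval N n \<longleftrightarrow> \<lfloor>real N * x\<rfloor> \<in> {- int n..<int n}"
    using trunc_interval_iff[OF assms, of "x - of_int \<lfloor>real N * x\<rfloor> / real N" "\<lfloor>real N * x\<rfloor>"] *[of "\<lfloor>real N * x\<rfloor>"]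
    by simp
  then show ?thesis
    unfolding indicator_def * by (simp add: of_bool_def sum.delta)
qed

lemma nn_integral_periodize:
  assumes "N > 0" and [measurable]: "g \<in> borel_measurable borel"
  shows "(\<integral>\<^sup>+ x. (\<Sum>k\<in>{- int n..<int n}. g (x + of_int k / real N)) * indicator {0..<1 / real N} x \<partial>lborel)
    = (\<integral>\<^sup>+ x. g x * indicator (trunc_interval N n) x \<partial>lborel)"
proof -
  have [measurable]: "trunc_interval N n \<in> sets borel" by (simp add: trunc_interval_def)
  have "(\<integral>\<^sup>+ x. (\<Sum>k\<in>{- int n..<int n}. g (x + of_int k / real N)) * indicator {0..<1 / real N} x \<partial>lborel)
      = (\<Sum>k\<in>{- int n..<int n}. \<integral>\<^sup>+ x. g (x + of_int k / real N) * indicator {0..<1 / real N} x \<partial>lborel)"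
    unfolding sum_distrib_right by (rule nn_integral_sum) measurable
  also have "\<dots> = (\<Sum>k\<in>{- int n..<int n}. \<integral>\<^sup>+ x. g x * indicator {0..<1 / real N} (x - of_int k / real N) \<partial>lborel)"
  proof (rule sum.cong[OF refl])
    fix k :: int
    show "(\<integral>\<^sup>+ x. g (x + of_int k / real N) * indicator {0..<1 / real N} x \<partial>lborel)
        = (\<integral>\<^sup>+ x. g x * indicator {0..<1 / real N} (x - of_int k / real N) \<partial>lborel)"
      using nn_integral_real_affine[of "\<lambda>x. g x * indicator {0..<1 / real N} (x - of_int k / real N)" 1 "of_int k / real N"]
      by (simp add: add.commute)
  qed
  also have "\<dots> = (\<integral>\<^sup>+ x. g x * indicator (trunc_interval N n) x \<partial>lborel)"
    unfolding sum_indicator_shift[OF assms(1), symmetric] sum_distrib_left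
    by (rule nn_integral_sum[symmetric]) measurable
  finally show ?thesis .
qed

text \<open>A finite sum makes sense at every point for every \<open>f\<close>, in contrast to the
  Zak series of a merely square-integrable function.\<close>

definition zak_sum :: "nat \<Rightarrow> nat \<Rightarrow> (real \<Rightarrow> complex) \<Rightarrow> real \<times> real \<Rightarrow> complex" where
  "zak_sum N n f = (\<lambda>(x, \<xi>). complex_of_real (1 / real N) *
     (\<Sum>k\<in>{- int n..<int n}. f (x + of_int k / real N) * cis (- 2 * pi * (of_int k / real N) * \<xi>)))"

lemma measurable_cis [measurable]: "cis \<in> borel_measurable borel"
  by (intro borel_measurable_continuous_onI continuous_intros)

lemma measurable_zak_sum [measurable]:
  assumes [measurable]: "f \<in> borel_measurable borel"
  shows "zak_sum N n f \<in> borel_measurable borel"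
  unfolding zak_sum_def borel_prod[symmetric] by measurable

text \<open>For fixed \<open>x\<close> this is Parseval for the coefficients
  \<open>f (x + k / N) / N\<close>; unfolding the cells then gives an integral over the line. The
  factor \<open>1 / N\<close> is the period \<open>N\<close> times the square of the normalisation
  \<open>1 / N\<close>.\<close>

lemma l2sq_zak_sum:
  assumes "N > 0" and [measurable]: "f \<in> borel_measurable borel"
  shows "l2sq (zak_measure N) (zak_sum N n f) =
    ennreal (1 / real N) * (\<integral>\<^sup>+ x. ennreal ((cmod (f x))\<^sup>2) * indicator (trunc_interval N n) x \<partial>lborel)"
proof -
  have [measurable]: "zak_sum N n f \<in> borel_measurable (borel \<Otimes>\<^sub>M borel)"
    using measurable_zak_sum[OF assms(2)] by (simp add: borel_prod)
  have inner: "(\<integral>\<^sup>+ \<xi>. ennreal ((cmod (zak_sum N n f (x, \<xi>)))\<^sup>2) * indicator {0..<real N} \<xi> \<partial>lborel)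
      = ennreal (1 / real N) * (\<Sum>k\<in>{- int n..<int n}. ennreal ((cmod (f (x + of_int k / real N)))\<^sup>2))" for x
  proof -
    have "(\<integral>\<^sup>+ \<xi>. ennreal ((cmod (zak_sum N n f (x, \<xi>)))\<^sup>2) * indicator {0..<real N} \<xi> \<partial>lborel)
      = ennreal (real N * (\<Sum>k\<in>{- int n..<int n}. (cmod (complex_of_real (1 / real N) * f (x + of_int k / real N)))\<^sup>2))"
      using parseval_finite[OF assms(1), of "{- int n..<int n}" "\<lambda>k. complex_of_real (1 / real N) * f (x + of_int k / real N)"]
      by (simp add: zak_sum_def sum_distrib_left mult.assoc)
    also have "real N * (\<Sum>k\<in>{- int n..<int n}. (cmod (complex_of_real (1 / real N) * f (x + of_int k / real N)))\<^sup>2)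
       = 1 / real N * (\<Sum>k\<in>{- int n..<int n}. (cmod (f (x + of_int k / real N)))\<^sup>2)"
      using assms(1) unfolding sum_distrib_left
      by (intro sum.cong refl) (simp add: norm_mult norm_divide power_divide field_simps power2_eq_square)
    finally show ?thesis
      using ennreal_mult[of "1 / real N" "\<Sum>k\<in>{- int n..<int n}. (cmod (f (x + of_int k / real N)))\<^sup>2"]
      by (simp add: sum_nonneg sum_ennreal)
  qed
  have "l2sq (zak_measure N) (zak_sum N n f) =
      (\<integral>\<^sup>+ x. ennreal (1 / real N) * ((\<Sum>k\<in>{- int n..<int n}. ennreal ((cmod (f (x + of_int k / real N)))\<^sup>2)) * indicator {0..<1 / real N} x) \<partial>lborel)"
    unfolding l2sq_def by (subst nn_integral_zak_measure(1)) (auto simp: inner mult.assoc)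
  also have "\<dots> = ennreal (1 / real N) * (\<integral>\<^sup>+ x. (\<Sum>k\<in>{- int n..<int n}. ennreal ((cmod (f (x + of_int k / real N)))\<^sup>2)) * indicator {0..<1 / real N} x \<partial>lborel)"
    by (rule nn_integral_cmult) measurable
  also note nn_integral_periodize[OF assms(1), of "\<lambda>x. ennreal ((cmod (f x))\<^sup>2)"]
  finally show ?thesis by simp
qed

section \<open>Extension of the Zak transform to square-integrable functions\<close>

lemma l2dist2_eq_l2sq: "l2dist2 f g = l2sq lborel (\<lambda>x. f x - g x)"
  by (simp add: l2dist2_def l2sq_def)

lemma sq_int_iff: "sq_int f \<longleftrightarrow> f \<in> borel_measurable borel \<and> l2sq lborel f < \<infinity>"
  by (simp add: sq_int_def l2sq_def)

lemma l2sq_cong: "(\<And>x. x \<in> space M \<Longrightarrow> f x = g x) \<Longrightarrow> l2sq M f = l2sq M g"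
  unfolding l2sq_def by (intro nn_integral_cong) simp

lemma l2sq_cmult:
  assumes [measurable]: "f \<in> borel_measurable M"
  shows "l2sq M (\<lambda>x. c * f x) = ennreal ((cmod c)\<^sup>2) * l2sq M f"
  unfolding l2sq_def by (simp add: norm_mult power_mult_distrib ennreal_mult nn_integral_cmult)

lemma l2sq_transl:
  fixes f :: "real \<Rightarrow> complex"
  assumes [measurable]: "f \<in> borel_measurable borel"
  shows "l2sq lborel (\<lambda>x. f (x - h)) = l2sq lborel f"
  unfolding l2sq_def
  using nn_integral_real_affine[of "\<lambda>x. ennreal ((cmod (f x))\<^sup>2)" 1 "- h"] by simp

lemma ennreal_tendsto_0_mono:
  fixes a b :: "nat \<Rightarrow> ennreal"
  assumes "b \<longlonglongrightarrow> 0" "\<And>n. a n \<le> b n"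
  shows "a \<longlonglongrightarrow> 0"
  by (rule tendsto_sandwich[OF _ _ tendsto_const assms(1)]) (use assms(2) in auto)

lemma l2sq_tendsto_sum:
  assumes "finite I" and [measurable]: "\<And>i n. i \<in> I \<Longrightarrow> u i n \<in> borel_measurable M"
    and "\<And>i. i \<in> I \<Longrightarrow> (\<lambda>n. l2sq M (u i n)) \<longlonglongrightarrow> 0"
  shows "(\<lambda>n::nat. l2sq M (\<lambda>x. \<Sum>i\<in>I. u i n x)) \<longlonglongrightarrow> 0"
  using assms
proof (induction I rule: finite_induct)
  case empty
  then show ?case by (simp add: l2sq_def)
next
  case (insert j I)
  note [measurable] = insert.prems(1)
  have lim: "(\<lambda>n. 2 * l2sq M (u j n) + 2 * l2sq M (\<lambda>x. \<Sum>i\<in>I. u i n x)) \<longlonglongrightarrow> 2 * 0 + 2 * 0"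
    using insert by (intro tendsto_add ennreal_tendsto_cmult) auto
  have "l2sq M (\<lambda>x. \<Sum>i\<in>insert j I. u i n x) \<le> 2 * l2sq M (u j n) + 2 * l2sq M (\<lambda>x. \<Sum>i\<in>I. u i n x)" for n
    using insert(1,2) by (simp, intro l2sq_add_le) measurable
  then show ?case
    by (rule ennreal_tendsto_0_mono[rotated]) (use lim in simp)
qed

text \<open>Bridge between the two descriptions of the transform: a truncation of a
  square-integrable function is integrable, so \<open>zak_L1\<close> applies to it, and on
  \<open>zak_dom\<close> its Zak series is the finite sum \<open>zak_sum N n f\<close>.\<close>

definition trunc :: "nat \<Rightarrow> nat \<Rightarrow> (real \<Rightarrow> complex) \<Rightarrow> real \<Rightarrow> complex" where
  "trunc N n f x = (if x \<in> trunc_interval N n then f x else 0)"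

lemma sets_trunc_interval [measurable]: "trunc_interval N n \<in> sets borel"
  by (simp add: trunc_interval_def)

lemma measurable_trunc [measurable]:
  assumes [measurable]: "f \<in> borel_measurable borel"
  shows "trunc N n f \<in> borel_measurable borel"
  unfolding trunc_def[abs_def] by measurable

lemma trunc_tendsto:
  assumes "sq_int f" "N > 0"
  shows "(\<lambda>n. l2sq lborel (\<lambda>x. trunc N n f x - f x)) \<longlonglongrightarrow> 0"
proof -
  have [measurable]: "f \<in> borel_measurable borel" and fin: "l2sq lborel f < \<infinity>"
    using assms by (auto simp: sq_int_iff)
  have "(\<lambda>n. l2sq lborel (\<lambda>x. trunc N n f x - f x)) \<longlonglongrightarrow> (\<integral>\<^sup>+ (x::real). 0 \<partial>lborel)"
    unfolding l2sq_def
  proof (rule nn_integral_dominated_convergence)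
    show "AE x in lborel. ennreal ((cmod (trunc N n f x - f x))\<^sup>2) \<le> ennreal ((cmod (f x))\<^sup>2)" for n
      by (auto simp: trunc_def)
    show "(\<integral>\<^sup>+ x. ennreal ((cmod (f x))\<^sup>2) \<partial>lborel) < \<infinity>"
      using fin by (simp add: l2sq_def)
    show "AE x in lborel. (\<lambda>n. ennreal ((cmod (trunc N n f x - f x))\<^sup>2)) \<longlonglongrightarrow> 0"
    proof (intro AE_I2 tendsto_eventually)
      fix x :: real
      obtain k :: nat where k: "real N * \<bar>x\<bar> < real k" using reals_Archimedean2 by blast
      show "\<forall>\<^sub>F n in sequentially. ennreal ((cmod (trunc N n f x - f x))\<^sup>2) = 0"
      proof (rule eventually_sequentiallyI[of k])
        fix n assume "k \<le> n"
        then have "real N * \<bar>x\<bar> < real n" using k by simp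
        then have "\<bar>x\<bar> < real n / real N" using assms(2) by (simp add: field_simps)
        then have "x \<in> trunc_interval N n" by (auto simp: trunc_interval_def)
        then show "ennreal ((cmod (trunc N n f x - f x))\<^sup>2) = 0" by (simp add: trunc_def)
      qed
    qed
  qed measurable
  then show ?thesis by simp
qed

lemma zak_sum_diff: "zak_sum N n (\<lambda>x. f x - g x) t = zak_sum N n f t - zak_sum N n g t"
  by (simp add: zak_sum_def split_beta algebra_simps sum_subtractf)

lemma zak_sum_trunc:
  assumes "N > 0" "t \<in> zak_dom N" "n \<le> m"
  shows "zak_sum N m (trunc N n f) t = zak_sum N n f t"
proof -
  obtain x \<xi> where t: "t = (x, \<xi>)" by (cases t)
  have x: "x \<in> {0..<1 / real N}" using assms(2) by (simp add: t zak_dom_def)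
  show ?thesis
    unfolding t zak_sum_def prod.case trunc_def trunc_interval_iff[OF assms(1) x]
    by (intro arg_cong2[of _ _ _ _ "(*)"] refl sum.mono_neutral_cong_right) (use assms(3) in auto)
qed

lemma l2sq_zak_sum_le:
  assumes "N > 0" and [measurable]: "f \<in> borel_measurable borel"
  shows "l2sq (zak_measure N) (zak_sum N n f) \<le> l2sq lborel f"
proof -
  have "l2sq (zak_measure N) (zak_sum N n f) \<le> 1 * l2sq lborel f"
    unfolding l2sq_zak_sum[OF assms] unfolding l2sq_def
    using assms(1) by (intro mult_mono nn_integral_mono) (auto simp: indicator_def)
  then show ?thesis by simp
qed

text \<open>For \<open>n \<le> m\<close> the difference of the partial sums is the
  \<open>m\<close>-th partial sum of the tail \<open>f - trunc N n f\<close>, whose norm bounds it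
  and tends to 0.\<close>

lemma zak_sum_cauchy:
  assumes "sq_int f" "N > 0" "e > 0"
  shows "\<exists>K. \<forall>m\<ge>K. \<forall>n\<ge>K. l2sq (zak_measure N) (\<lambda>t. zak_sum N m f t - zak_sum N n f t) < ennreal e"
proof -
  have [measurable]: "f \<in> borel_measurable borel" using assms by (auto simp: sq_int_iff)
  have "eventually (\<lambda>n. l2sq lborel (\<lambda>x. trunc N n f x - f x) < ennreal e) sequentially"
    using assms by (intro order_tendstoD(2)[OF trunc_tendsto]) auto
  then obtain K where K: "\<And>n. n \<ge> K \<Longrightarrow> l2sq lborel (\<lambda>x. trunc N n f x - f x) < ennreal e"
    by (auto simp: eventually_sequentially)
  have *: "l2sq (zak_measure N) (\<lambda>t. zak_sum N m f t - zak_sum N n f t) < ennreal e"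
    if "n \<ge> K" "n \<le> m" for m n
  proof -
    have "l2sq (zak_measure N) (\<lambda>t. zak_sum N m f t - zak_sum N n f t) =
        l2sq (zak_measure N) (zak_sum N m (\<lambda>x. f x - trunc N n f x))"
      by (rule l2sq_cong) (auto simp: zak_sum_diff zak_sum_trunc assms that space_restrict_space)
    also have "\<dots> \<le> l2sq lborel (\<lambda>x. f x - trunc N n f x)"
      by (rule l2sq_zak_sum_le) (use assms in auto)
    also have "\<dots> < ennreal e" using K[OF that(1)] by (simp add: l2sq_diff_commute)
    finally show ?thesis .
  qed
  show ?thesis
  proof (intro exI[of _ K] allI impI)
    fix m n assume "K \<le> m" "K \<le> n"
    then show "l2sq (zak_measure N) (\<lambda>t. zak_sum N m f t - zak_sum N n f t) < ennreal e"
      using *[of n m] *[of m n] l2sq_diff_commute[of _ "zak_sum N m f" "zak_sum N n f"]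
      by (cases "n \<le> m") auto
  qed
qed

section \<open>Pointwise convergence of the Zak series of an integrable function\<close>

lemma filterlim_symmetric_int_interval:
  "filterlim (\<lambda>n. {- int n..<int n}) (finite_subsets_at_top UNIV) sequentially"
  unfolding filterlim_finite_subsets_at_top
proof (intro allI impI)
  fix X :: "int set" assume "finite X \<and> X \<subseteq> UNIV"
  then have fin: "finite ((\<lambda>k. nat \<bar>k\<bar>) ` X)" by simp
  define K where "K = Suc (Max (insert 0 ((\<lambda>k. nat \<bar>k\<bar>) ` X)))"
  have "nat \<bar>k\<bar> < K" if "k \<in> X" for k
    unfolding K_def using fin that by (intro le_imp_less_Suc Max_ge) auto
  then have "X \<subseteq> {- int n..<int n}" if "n \<ge> K" for n
    using that by (force simp: subset_eq)
  then show "\<forall>\<^sub>F n in sequentially. finite {- int n..<int n} \<and> X \<subseteq> {- int n..<int n} \<and> {- int n..<int n} \<subseteq> UNIV"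
    by (intro eventually_sequentiallyI[of K]) auto
qed

lemma summable_on_int_of_bounded:
  fixes g :: "int \<Rightarrow> real"
  assumes "\<And>k. g k \<ge> 0" "\<And>n. (\<Sum>k\<in>{- int n..<int n}. g k) \<le> C"
  shows "g summable_on UNIV"
proof (rule nonneg_bdd_above_summable_on)
  show "bdd_above (sum g ` {F. F \<subseteq> UNIV \<and> finite F})"
  proof (rule bdd_aboveI2)
    fix F :: "int set" assume "F \<in> {F. F \<subseteq> UNIV \<and> finite F}"
    then have "eventually (\<lambda>n. F \<subseteq> {- int n..<int n}) sequentially"
      using filterlim_symmetric_int_interval unfolding filterlim_finite_subsets_at_top
      by (auto elim: eventually_mono)
    then obtain n where "F \<subseteq> {- int n..<int n}" by (auto simp: eventually_sequentially)
    then have "sum g F \<le> (\<Sum>k\<in>{- int n..<int n}. g k)"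
      by (intro sum_mono2) (auto simp: assms)
    also note assms(2)
    finally show "sum g F \<le> C" .
  qed
qed (simp add: assms)

text \<open>The periodisation of \<open>|f|\<close> has finite integral over the fundamental domain,
  so the series converges absolutely at almost every point. Absolute convergence identifies the
  unordered sum in \<open>zak_L1\<close> with the limit of symmetric partial sums.\<close>

lemma zak_sum_tendsto_zak_L1:
  assumes "integrable lborel f" "N > 0"
  shows "AE t in zak_measure N. (\<lambda>n. zak_sum N n f t) \<longlonglongrightarrow> zak_L1 N f t"
proof -
  have [measurable]: "f \<in> borel_measurable borel" using assms(1) by (simp add: integrable_iff_bounded)
  define G where "G n t = (\<Sum>k\<in>{- int n..<int n}. ennreal (cmod (f (fst t + of_int k / real N))))" for n and t :: "real \<times> real"
  have "G n \<in> borel_measurable (borel \<Otimes>\<^sub>M borel)" for n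
    unfolding G_def by measurable
  then have [measurable]: "G n \<in> borel_measurable borel" for n by (simp add: borel_prod)
  have "nn_integral (zak_measure N) (G n) \<le> ennreal (real N) * (\<integral>\<^sup>+ x. ennreal (cmod (f x)) \<partial>lborel)" for n
  proof -
    have "nn_integral (zak_measure N) (G n) =
       (\<integral>\<^sup>+ x. ennreal (cmod (f x)) * indicator (trunc_interval N n) x \<partial>lborel) * (\<integral>\<^sup>+ \<xi>. indicator {0..<real N} \<xi> \<partial>lborel)"
      by (subst nn_integral_zak_measure(2)) (auto simp: G_def nn_integral_periodize[OF assms(2), of "\<lambda>x. ennreal (cmod (f x))"] nn_integral_cmult simp del: sum_ennreal)
    also have "\<dots> \<le> (\<integral>\<^sup>+ x. ennreal (cmod (f x)) \<partial>lborel) * ennreal (real N)"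
    proof (rule mult_mono)
      show "(\<integral>\<^sup>+ x. ennreal (cmod (f x)) * indicator (trunc_interval N n) x \<partial>lborel)
          \<le> (\<integral>\<^sup>+ x. ennreal (cmod (f x)) \<partial>lborel)"
        by (intro nn_integral_mono) (auto simp: indicator_def)
    qed auto
    finally show ?thesis by (simp add: mult.commute)
  qed
  then have "(SUP n. nn_integral (zak_measure N) (G n)) \<le> ennreal (real N) * (\<integral>\<^sup>+ x. ennreal (cmod (f x)) \<partial>lborel)"
    by (rule SUP_least)
  also have "\<dots> < \<infinity>"
    using assms(1) by (auto simp: integrable_iff_bounded ennreal_mult_less_top)
  also have "(SUP n. nn_integral (zak_measure N) (G n)) = (\<integral>\<^sup>+ t. (SUP n. G n t) \<partial>zak_measure N)"
  proof (rule nn_integral_monotone_convergence_SUP[symmetric])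
    show "incseq G" unfolding G_def incseq_def le_fun_def by (auto intro!: sum_mono2 simp del: sum_ennreal)
    show "G n \<in> borel_measurable (zak_measure N)" for n by (rule measurable_zak_measure) simp
  qed
  finally have "AE t in zak_measure N. (SUP n. G n t) \<noteq> \<infinity>"
    by (intro nn_integral_PInf_AE) (auto intro!: measurable_zak_measure borel_measurable_SUP)
  then show ?thesis
  proof eventually_elim
    fix t :: "real \<times> real" assume fin: "(SUP n. G n t) \<noteq> \<infinity>"
    obtain x \<xi> where t: "t = (x, \<xi>)" by (cases t)
    let ?u = "\<lambda>k. f (x + of_int k / real N) * cis (- 2 * pi * (of_int k / real N) * \<xi>)"
    have "(\<Sum>k\<in>{- int n..<int n}. norm (?u k)) \<le> enn2real (SUP n. G n t)" for n
    proof -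
      have "ennreal (\<Sum>k\<in>{- int n..<int n}. norm (?u k)) = G n t"
        by (simp add: G_def t norm_mult sum_ennreal)
      also have "\<dots> \<le> (SUP n. G n t)" by (rule SUP_upper) simp
      finally have "enn2real (ennreal (\<Sum>k\<in>{- int n..<int n}. norm (?u k))) \<le> enn2real (SUP n. G n t)"
        using fin by (intro enn2real_mono) (simp_all only: infinity_ennreal_def less_top)
      then show ?thesis by (simp add: sum_nonneg)
    qed
    then have "(\<lambda>k. norm (?u k)) summable_on UNIV"
      by (intro summable_on_int_of_bounded) auto
    then have "?u summable_on UNIV" by (rule abs_summable_summable)
    then have "(sum ?u \<longlongrightarrow> infsum ?u UNIV) (finite_subsets_at_top UNIV)"
      using has_sum_infsum has_sum_def by blast
    from filterlim_compose[OF this filterlim_symmetric_int_interval]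
    show "(\<lambda>n. zak_sum N n f t) \<longlonglongrightarrow> zak_L1 N f t"
      unfolding zak_sum_def zak_L1_def t prod.case by (intro tendsto_mult tendsto_const)
  qed
qed

lemma is_zak_L2_exists:
  assumes "sq_int f" "N > 0"
  shows "\<exists>Z. is_zak_L2 N f Z"
proof -
  let ?M = "zak_measure N"
  have f [measurable]: "f \<in> borel_measurable borel" and fin: "l2sq lborel f < \<infinity>"
    using assms by (auto simp: sq_int_iff)
  have ms: "zak_sum N n g \<in> borel_measurable ?M" if "g \<in> borel_measurable borel" for n g
    using that by (intro measurable_zak_measure measurable_zak_sum)
  obtain Z0 where Z0: "Z0 \<in> borel_measurable ?M" "(\<lambda>n. l2sq ?M (\<lambda>t. zak_sum N n f t - Z0 t)) \<longlonglongrightarrow> 0"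
    using l2sq_complete[OF ms[OF f] zak_sum_cauchy[OF assms]] by blast
  \<comment> \<open>\<open>Z0\<close> is measurable only on the fundamental domain; extension by
    zero makes it Borel on the whole plane.\<close>
  define Z where "Z t = indicator (zak_dom N) t *\<^sub>R Z0 t" for t
  have Zb: "Z \<in> borel_measurable lborel"
    using Z0(1) unfolding Z_def[abs_def] by (subst (asm) borel_measurable_restrict_space_iff) auto
  then have [measurable]: "Z \<in> borel_measurable ?M" by (simp add: measurable_zak_measure)
  have Zlim: "(\<lambda>n. l2sq ?M (\<lambda>t. zak_sum N n f t - Z t)) \<longlonglongrightarrow> 0"
  proof -
    have "l2sq ?M (\<lambda>t. zak_sum N n f t - Z t) = l2sq ?M (\<lambda>t. zak_sum N n f t - Z0 t)" for n
      by (rule l2sq_cong) (simp add: Z_def space_restrict_space)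
    then show ?thesis using Z0(2) by simp
  qed
  have "l2sq ?M Z < \<infinity>"
  proof -
    have "eventually (\<lambda>n. l2sq ?M (\<lambda>t. zak_sum N n f t - Z t) < 1) sequentially"
      by (rule order_tendstoD(2)[OF Zlim]) simp
    then obtain n where n: "l2sq ?M (\<lambda>t. zak_sum N n f t - Z t) < 1" by (auto simp: eventually_sequentially)
    have "l2sq ?M Z \<le> 2 * l2sq ?M (\<lambda>t. zak_sum N n f t - Z t) + 2 * l2sq ?M (zak_sum N n f)"
      using l2sq_triangle[of Z ?M "zak_sum N n f" "\<lambda>_. 0"] ms[OF f] by (simp add: l2sq_diff_commute)
    also have "\<dots> \<le> 2 * 1 + 2 * l2sq lborel f"
      using n l2sq_zak_sum_le[OF assms(2) f, of n] by (intro add_mono mult_left_mono) auto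
    also have "\<dots> < \<infinity>" using fin by (simp add: ennreal_mult_less_top)
    finally show ?thesis .
  qed
  moreover have "(\<lambda>n. l2sq ?M (\<lambda>t. zak_L1 N (g n) t - Z t)) \<longlonglongrightarrow> 0"
    if g: "\<And>n. integrable lborel (g n) \<and> sq_int (g n)" and lim: "(\<lambda>n. l2dist2 (g n) f) \<longlonglongrightarrow> 0" for g
  proof -
    have [measurable]: "g n \<in> borel_measurable borel" for n using g by (simp add: sq_int_iff)
    \<comment> \<open>Partial sums contract norms, so those of \<open>g n\<close> stay close to
      those of \<open>f\<close> uniformly in \<open>l\<close>. Fatou carries this over to the
      pointwise limit \<open>zak_L1 N (g n)\<close>.\<close>
    have le: "l2sq ?M (\<lambda>t. zak_L1 N (g n) t - Z t) \<le> 2 * l2dist2 (g n) f" for n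
    proof -
      have "l2sq ?M (\<lambda>t. zak_L1 N (g n) t - Z t) \<le> liminf (\<lambda>l. l2sq ?M (\<lambda>t. Z t - zak_sum N l (g n) t))"
        unfolding l2sq_diff_commute[of _ "zak_L1 N (g n)"]
        by (rule l2sq_fatou) (use g zak_sum_tendsto_zak_L1 assms ms in auto)
      also have "\<dots> \<le> liminf (\<lambda>l. 2 * l2sq ?M (\<lambda>t. zak_sum N l f t - Z t) + 2 * l2dist2 (g n) f)"
      proof (intro Liminf_mono always_eventually allI)
        fix l
        have "l2sq ?M (\<lambda>t. Z t - zak_sum N l (g n) t) \<le>
          2 * l2sq ?M (\<lambda>t. Z t - zak_sum N l f t) + 2 * l2sq ?M (\<lambda>t. zak_sum N l f t - zak_sum N l (g n) t)"
          by (rule l2sq_triangle) (auto intro: ms)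
        also have "l2sq ?M (\<lambda>t. zak_sum N l f t - zak_sum N l (g n) t) \<le> l2sq lborel (\<lambda>x. f x - g n x)"
          using l2sq_zak_sum_le[OF assms(2), of "\<lambda>x. f x - g n x" l] by (simp add: zak_sum_diff[abs_def])
        finally show "l2sq ?M (\<lambda>t. Z t - zak_sum N l (g n) t) \<le> 2 * l2sq ?M (\<lambda>t. zak_sum N l f t - Z t) + 2 * l2dist2 (g n) f"
          by (simp add: l2dist2_eq_l2sq l2sq_diff_commute[of _ f] l2sq_diff_commute[of _ Z] add_left_mono mult_left_mono)
      qed
      also have "\<dots> = 2 * 0 + 2 * l2dist2 (g n) f"
        by (intro lim_imp_Liminf tendsto_add tendsto_const ennreal_tendsto_cmult Zlim) auto
      finally show ?thesis by simp
    qed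
    have "(\<lambda>n. 2 * l2dist2 (g n) f) \<longlonglongrightarrow> 2 * 0"
      by (intro ennreal_tendsto_cmult lim) auto
    then show ?thesis
      by (intro ennreal_tendsto_0_mono[OF _ le]) simp
  qed
  ultimately have "is_zak_L2 N f Z"
    unfolding is_zak_L2_def l2sq_zak_measure[symmetric] using Zb by auto
  then show ?thesis by blast
qed

text \<open>The defining convergence of \<open>Z\<close> is tested on the truncations of
  \<open>f\<close>, which turns the abstract extension into a concrete limit of finite sums.\<close>

lemma zak_sum_tendsto:
  assumes "sq_int f" "N > 0" "is_zak_L2 N f Z"
  shows "(\<lambda>n. l2sq (zak_measure N) (\<lambda>t. zak_sum N n f t - Z t)) \<longlonglongrightarrow> 0"
proof -
  have f [measurable]: "f \<in> borel_measurable borel" and fin: "l2sq lborel f < \<infinity>"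
    using assms by (auto simp: sq_int_iff)
  have le: "l2sq lborel (trunc N n f) \<le> l2sq lborel f" for n
    unfolding l2sq_def by (intro nn_integral_mono) (auto simp: trunc_def)
  have "sq_int (trunc N n f)" for n
    using le_less_trans[OF le fin] by (auto simp: sq_int_iff)
  moreover have "integrable lborel (trunc N n f)" for n
  proof -
    have "(\<integral>\<^sup>+ x. ennreal (norm (trunc N n f x)) \<partial>lborel)
        \<le> (\<integral>\<^sup>+ x. ennreal ((cmod (f x))\<^sup>2) + indicator (trunc_interval N n) x \<partial>lborel)"
    proof (rule nn_integral_mono)
      fix x :: real
      \<comment> \<open>On a bounded interval square integrability implies integrability; this
        pointwise bound shows it without Cauchy-Schwarz.\<close>
      have "cmod (f x) \<le> (cmod (f x))\<^sup>2 + 1"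
        using sum_squares_bound[of "cmod (f x)" 1] norm_ge_zero[of "f x"] by (simp del: norm_ge_zero)
      then have "ennreal (cmod (f x)) \<le> ennreal ((cmod (f x))\<^sup>2 + 1)" by (rule ennreal_leI)
      then show "ennreal (norm (trunc N n f x)) \<le> ennreal ((cmod (f x))\<^sup>2) + indicator (trunc_interval N n) x"
        by (auto simp: trunc_def)
    qed
    also have "\<dots> = l2sq lborel f + emeasure lborel (trunc_interval N n)"
      unfolding l2sq_def by (subst nn_integral_add) auto
    also have "\<dots> < \<infinity>"
      using fin by (simp add: trunc_interval_def)
    finally show ?thesis by (simp add: integrable_iff_bounded)
  qed
  moreover have "(\<lambda>n. l2dist2 (trunc N n f) f) \<longlonglongrightarrow> 0"
    unfolding l2dist2_eq_l2sq using assms by (intro trunc_tendsto)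
  ultimately have "(\<lambda>n. l2sq (zak_measure N) (\<lambda>t. zak_L1 N (trunc N n f) t - Z t)) \<longlonglongrightarrow> 0"
    using assms(3) unfolding is_zak_L2_def l2sq_zak_measure[symmetric]
    by (elim conjE allE[of _ "\<lambda>n. trunc N n f"]) simp
  moreover have "l2sq (zak_measure N) (\<lambda>t. zak_L1 N (trunc N n f) t - Z t) =
      l2sq (zak_measure N) (\<lambda>t. zak_sum N n f t - Z t)" for n
  proof (rule l2sq_cong)
    fix t assume "t \<in> space (zak_measure N)"
    then have t: "t \<in> zak_dom N" by (simp add: space_restrict_space)
    obtain x \<xi> where tx: "t = (x, \<xi>)" by (cases t)
    have x: "x \<in> {0..<1 / real N}" using t by (simp add: tx zak_dom_def)
    let ?u = "\<lambda>k. trunc N n f (x + of_int k / real N) * cis (- 2 * pi * (of_int k / real N) * \<xi>)"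
    have "infsum ?u UNIV = infsum ?u {- int n..<int n}"
      using trunc_interval_iff[OF assms(2) x] by (intro infsum_cong_neutral) (auto simp: trunc_def)
    then have "zak_L1 N (trunc N n f) t = zak_sum N n (trunc N n f) t"
      by (simp add: zak_L1_def zak_sum_def tx)
    then show "zak_L1 N (trunc N n f) t - Z t = zak_sum N n f t - Z t"
      by (simp add: zak_sum_trunc assms(2) t)
  qed
  ultimately show ?thesis by simp
qed

section \<open>Translations by multiples of \<open>1 / N\<close> as multipliers in frequency\<close>

lemma zak_sum_trunc_shift:
  assumes "N > 0" "t \<in> zak_dom N" "n + nat \<bar>r\<bar> \<le> L"
  shows "zak_sum N L (\<lambda>x. trunc N n f (x - of_int r / real N)) t =
    cis (- 2 * pi * (of_int r / real N) * snd t) * zak_sum N n f t"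
proof -
  obtain x \<xi> where t: "t = (x, \<xi>)" by (cases t)
  have x: "x \<in> {0..<1 / real N}" using assms(2) by (simp add: t zak_dom_def)
  have arg: "x + of_int k / real N - of_int r / real N = x + of_int (k - r) / real N" for k
    by (simp add: diff_divide_distrib)
  \<comment> \<open>The truncation confines the sum to a window of \<open>2 * n\<close> indices
    moved by \<open>r\<close>. The bound on \<open>L\<close> keeps the window inside the range of
    summation, so the shift loses no terms.\<close>
  have "(\<Sum>k\<in>{- int L..<int L}. trunc N n f (x + of_int k / real N - of_int r / real N) * cis (- 2 * pi * (of_int k / real N) * \<xi>))
     = (\<Sum>k\<in>{r - int n..<r + int n}. f (x + of_int (k - r) / real N) * cis (- 2 * pi * (of_int k / real N) * \<xi>))"
    unfolding arg trunc_def trunc_interval_iff[OF assms(1) x]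
    by (intro sum.mono_neutral_cong_right) (use assms(3) in auto)
  also have "\<dots> = (\<Sum>k\<in>{- int n..<int n}. f (x + of_int k / real N) * cis (- 2 * pi * (of_int (k + r) / real N) * \<xi>))"
    by (rule sum.reindex_bij_witness[of _ "\<lambda>k. k + r" "\<lambda>k. k - r"]) auto
  also have "\<dots> = cis (- 2 * pi * (of_int r / real N) * \<xi>) *
      (\<Sum>k\<in>{- int n..<int n}. f (x + of_int k / real N) * cis (- 2 * pi * (of_int k / real N) * \<xi>))"
  proof -
    have "cis (- 2 * pi * (of_int (k + r) / real N) * \<xi>) =
        cis (- 2 * pi * (of_int r / real N) * \<xi>) * cis (- 2 * pi * (of_int k / real N) * \<xi>)" for k
      unfolding cis_mult by (rule arg_cong[of _ _ cis]) (simp add: add_divide_distrib ring_distribs)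
    then show ?thesis by (simp only: sum_distrib_left mult_ac)
  qed
  finally show ?thesis by (simp add: t zak_sum_def)
qed

text \<open>The frequency side of \<open>shift_comb\<close>. Frequencies come as a family over an
  arbitrary index type, so repeated frequencies need no merging; later the index set is a disjoint
  union of two sets of integers.\<close>

definition zak_mult :: "nat \<Rightarrow> 'i set \<Rightarrow> ('i \<Rightarrow> complex) \<Rightarrow> ('i \<Rightarrow> int) \<Rightarrow> real \<Rightarrow> complex" where
  "zak_mult N I c r \<xi> = (\<Sum>i\<in>I. c i * cis (- 2 * pi * (of_int (r i) / real N) * \<xi>))"

definition shift_comb :: "nat \<Rightarrow> 'i set \<Rightarrow> ('i \<Rightarrow> complex) \<Rightarrow> ('i \<Rightarrow> int) \<Rightarrow> (real \<Rightarrow> complex) \<Rightarrow> real \<Rightarrow> complex" where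
  "shift_comb N I c r f x = (\<Sum>i\<in>I. c i * f (x - of_int (r i) / real N))"

lemma measurable_zak_mult [measurable]: "zak_mult N I c r \<in> borel_measurable borel"
  unfolding zak_mult_def[abs_def] by measurable

lemma measurable_shift_comb [measurable]:
  assumes [measurable]: "f \<in> borel_measurable borel"
  shows "shift_comb N I c r f \<in> borel_measurable borel"
  unfolding shift_comb_def[abs_def] by measurable

lemma cmod_zak_mult_le: "cmod (zak_mult N I c r \<xi>) \<le> (\<Sum>i\<in>I. cmod (c i))"
  unfolding zak_mult_def by (rule order_trans[OF norm_sum]) (simp add: norm_mult)

lemma l2sq_zak_mult_zak_sum:
  assumes "N > 0" "finite I" and [measurable]: "f \<in> borel_measurable borel"
  shows "l2sq (zak_measure N) (\<lambda>t. zak_mult N I c r (snd t) * zak_sum N n f t) =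
    ennreal (1 / real N) * l2sq lborel (shift_comb N I c r (trunc N n f))"
proof -
  \<comment> \<open>Large enough to cover the support of every shifted truncation at once, so that
    the norm identity for \<open>zak_sum\<close> at level \<open>L\<close> sees the whole
    combination.\<close>
  define L where "L = n + (\<Sum>i\<in>I. nat \<bar>r i\<bar>)"
  have L: "n + nat \<bar>r i\<bar> \<le> L" if "i \<in> I" for i
    unfolding L_def using that assms(2) member_le_sum[of i I "\<lambda>i. nat \<bar>r i\<bar>"] by auto
  let ?g = "shift_comb N I c r (trunc N n f)"
  have "zak_mult N I c r (snd t) * zak_sum N n f t = zak_sum N L ?g t" if "t \<in> zak_dom N" for t
  proof -
    obtain x \<xi> where t: "t = (x, \<xi>)" by (cases t)
    have "zak_sum N L ?g t = (\<Sum>i\<in>I. c i * zak_sum N L (\<lambda>x. trunc N n f (x - of_int (r i) / real N)) t)"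
      unfolding t zak_sum_def shift_comb_def prod.case sum_distrib_left sum_distrib_right
      by (subst sum.swap) (simp only: mult_ac)
    also have "\<dots> = (\<Sum>i\<in>I. c i * (cis (- 2 * pi * (of_int (r i) / real N) * snd t) * zak_sum N n f t))"
      using zak_sum_trunc_shift[OF assms(1) that L] by (intro sum.cong) auto
    finally show ?thesis by (simp add: zak_mult_def sum_distrib_right mult.assoc)
  qed
  then have "l2sq (zak_measure N) (\<lambda>t. zak_mult N I c r (snd t) * zak_sum N n f t) =
      l2sq (zak_measure N) (zak_sum N L ?g)"
    by (intro l2sq_cong) (simp add: space_restrict_space)
  also have "\<dots> = ennreal (1 / real N) * (\<integral>\<^sup>+ x. ennreal ((cmod (?g x))\<^sup>2) * indicator (trunc_interval N L) x \<partial>lborel)"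
    by (rule l2sq_zak_sum) (use assms in auto)
  also have "(\<integral>\<^sup>+ x. ennreal ((cmod (?g x))\<^sup>2) * indicator (trunc_interval N L) x \<partial>lborel) = l2sq lborel ?g"
    unfolding l2sq_def
  proof (rule nn_integral_cong)
    fix x :: real
    have "?g x = 0" if x: "x \<notin> trunc_interval N L"
    proof -
      have "trunc N n f (x - of_int (r i) / real N) = 0" if i: "i \<in> I" for i
      proof -
        have le: "(real n + \<bar>real_of_int (r i)\<bar>) / real N \<le> real L / real N"
          using L[OF i] by (intro divide_right_mono) linarith+
        have "\<bar>real_of_int (r i)\<bar> / real N = \<bar>of_int (r i) / real N\<bar>" by simp
        then have "x - of_int (r i) / real N \<notin> trunc_interval N n"
          using le x unfolding trunc_interval_def add_divide_distrib atLeastLessThan_iff by linarith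
        then show ?thesis by (simp add: trunc_def)
      qed
      then show ?thesis by (simp add: shift_comb_def)
    qed
    then show "ennreal ((cmod (?g x))\<^sup>2) * indicator (trunc_interval N L) x = ennreal ((cmod (?g x))\<^sup>2)"
      by (cases "x \<in> trunc_interval N L") auto
  qed
  finally show ?thesis .
qed

text \<open>The same limit passage run in both directions from one exact identity for truncations.
  Its constants \<open>1 / N\<close> and \<open>N\<close> acquire the factor 4 of
  \<open>l2sq_limit_le\<close>.\<close>

lemma l2sq_zak_mult:
  assumes "sq_int f" "N > 0" "is_zak_L2 N f Z" "finite I"
  shows "l2sq (zak_measure N) (\<lambda>t. zak_mult N I c r (snd t) * Z t)
      \<le> 4 * ennreal (1 / real N) * l2sq lborel (shift_comb N I c r f)"
    and "l2sq lborel (shift_comb N I c r f)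
      \<le> 4 * ennreal (real N) * l2sq (zak_measure N) (\<lambda>t. zak_mult N I c r (snd t) * Z t)"
proof -
  let ?M = "zak_measure N" and ?P = "\<lambda>t::real \<times> real. zak_mult N I c r (snd t)"
  have f [measurable]: "f \<in> borel_measurable borel"
    using assms by (auto simp: sq_int_iff)
  have "Z \<in> borel_measurable borel" using assms(3) by (simp add: is_zak_L2_def)
  then have Z [measurable]: "Z \<in> borel_measurable ?M" by (rule measurable_zak_measure)
  have "?P \<in> borel_measurable (borel \<Otimes>\<^sub>M borel)" by measurable
  then have P [measurable]: "?P \<in> borel_measurable ?M"
    by (intro measurable_zak_measure) (simp add: borel_prod)
  have S [measurable]: "zak_sum N n f \<in> borel_measurable ?M" for n
    by (intro measurable_zak_measure measurable_zak_sum f)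
  \<comment> \<open>A bound for the multiplier uniform in \<open>\<xi>\<close>, so multiplying by it
    preserves \<open>L2\<close> convergence.\<close>
  define B where "B = (\<Sum>i\<in>I. cmod (c i))"
  have h: "(\<lambda>n. l2sq ?M (\<lambda>t. ?P t * zak_sum N n f t - ?P t * Z t)) \<longlonglongrightarrow> 0"
  proof (rule ennreal_tendsto_0_mono)
    show "(\<lambda>n. ennreal (B\<^sup>2) * l2sq ?M (\<lambda>t. zak_sum N n f t - Z t)) \<longlonglongrightarrow> 0"
      using ennreal_tendsto_cmult[OF _ zak_sum_tendsto[OF assms(1-3)], of "ennreal (B\<^sup>2)"] by simp
    show "l2sq ?M (\<lambda>t. ?P t * zak_sum N n f t - ?P t * Z t) \<le> ennreal (B\<^sup>2) * l2sq ?M (\<lambda>t. zak_sum N n f t - Z t)" for n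
      unfolding l2sq_def
      by (subst nn_integral_cmult[symmetric], measurable)
        (auto simp: ennreal_mult[symmetric] right_diff_distrib[symmetric] norm_mult power_mult_distrib B_def
          intro!: nn_integral_mono ennreal_leI mult_right_mono power_mono cmod_zak_mult_le)
  qed
  have g: "(\<lambda>n. l2sq lborel (\<lambda>x. shift_comb N I c r (trunc N n f) x - shift_comb N I c r f x)) \<longlonglongrightarrow> 0"
    unfolding shift_comb_def sum_subtractf[symmetric] right_diff_distrib[symmetric]
  proof (rule l2sq_tendsto_sum[OF assms(4)])
    fix i
    let ?h = "of_int (r i) / real N"
    have "l2sq lborel (\<lambda>x. c i * (trunc N n f (x - ?h) - f (x - ?h))) =
        ennreal ((cmod (c i))\<^sup>2) * l2sq lborel (\<lambda>x. trunc N n f x - f x)" for n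
      using l2sq_transl[of "\<lambda>x. trunc N n f x - f x" ?h] by (simp add: l2sq_cmult)
    then show "(\<lambda>n. l2sq lborel (\<lambda>x. c i * (trunc N n f (x - ?h) - f (x - ?h)))) \<longlonglongrightarrow> 0"
      using ennreal_tendsto_cmult[OF _ trunc_tendsto[OF assms(1,2)], of "ennreal ((cmod (c i))\<^sup>2)"] by simp
  qed measurable
  have eq: "l2sq ?M (\<lambda>t. ?P t * zak_sum N n f t) =
      ennreal (1 / real N) * l2sq lborel (shift_comb N I c r (trunc N n f))" for n
    by (rule l2sq_zak_mult_zak_sum) (use assms f in auto)
  have "ennreal (real N) * ennreal (1 / real N) = 1"
    using assms(2) by (simp add: ennreal_mult[symmetric])
  then have eq': "l2sq lborel (shift_comb N I c r (trunc N n f)) =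
      ennreal (real N) * l2sq ?M (\<lambda>t. ?P t * zak_sum N n f t)" for n
    unfolding eq mult.assoc[symmetric] by simp
  show "l2sq ?M (\<lambda>t. ?P t * Z t) \<le> 4 * ennreal (1 / real N) * l2sq lborel (shift_comb N I c r f)"
    by (rule l2sq_limit_le[OF _ _ _ _ h g eq]) auto
  show "l2sq lborel (shift_comb N I c r f) \<le> 4 * ennreal (real N) * l2sq ?M (\<lambda>t. ?P t * Z t)"
    by (rule l2sq_limit_le[OF _ _ _ _ g h eq']) auto
qed

section \<open>Frequency slices\<close>

lemma nn_integral_split_unit_intervals:
  assumes [measurable]: "g \<in> borel_measurable borel"
  shows "(\<integral>\<^sup>+ \<xi>. g \<xi> * indicator {0..<real N} \<xi> \<partial>lborel) =
    (\<Sum>p<N. \<integral>\<^sup>+ \<xi>. g (\<xi> + real p) * indicator {0..<1} \<xi> \<partial>lborel)"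
proof (induction N)
  case (Suc N)
  have "(\<integral>\<^sup>+ \<xi>. g \<xi> * indicator {0..<real (Suc N)} \<xi> \<partial>lborel) =
      (\<integral>\<^sup>+ \<xi>. g \<xi> * indicator {0..<real N} \<xi> + g \<xi> * indicator {0..<1} (\<xi> - real N) \<partial>lborel)"
    by (intro nn_integral_cong) (auto simp: indicator_def)
  also have "\<dots> = (\<integral>\<^sup>+ \<xi>. g \<xi> * indicator {0..<real N} \<xi> \<partial>lborel) +
      (\<integral>\<^sup>+ \<xi>. g \<xi> * indicator {0..<1} (\<xi> - real N) \<partial>lborel)"
    by (rule nn_integral_add) measurable
  also have "(\<integral>\<^sup>+ \<xi>. g \<xi> * indicator {0..<1} (\<xi> - real N) \<partial>lborel) =
      (\<integral>\<^sup>+ \<xi>. g (\<xi> + real N) * indicator {0..<1} \<xi> \<partial>lborel)"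
    using nn_integral_real_affine[of "\<lambda>\<xi>. g \<xi> * indicator {0..<1} (\<xi> - real N)" 1 "real N"]
    by (simp add: add.commute)
  finally show ?case using Suc by simp
qed simp

text \<open>The orthogonality condition is an almost-everywhere statement on three-dimensional space
  with \<open>\<xi>\<close> last, while the slice estimates fix \<open>\<xi>\<close> before
  integrating in \<open>x\<close> and \<open>y\<close>.\<close>

lemma nn_integral_lborel_triple:
  fixes G :: "real \<times> real \<times> real \<Rightarrow> ennreal"
  assumes [measurable]: "G \<in> borel_measurable (borel \<Otimes>\<^sub>M borel \<Otimes>\<^sub>M borel)"
  shows "nn_integral lborel G = (\<integral>\<^sup>+ \<xi>. \<integral>\<^sup>+ x. \<integral>\<^sup>+ y. G (x, y, \<xi>) \<partial>lborel \<partial>lborel \<partial>lborel)"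
proof -
  have "nn_integral lborel G = (\<integral>\<^sup>+ x. \<integral>\<^sup>+ t. G (x, t) \<partial>(lborel \<Otimes>\<^sub>M lborel) \<partial>lborel)"
    unfolding lborel_prod using assms by (subst lborel.nn_integral_fst) (auto simp: lborel_prod borel_prod)
  also have "\<dots> = (\<integral>\<^sup>+ x. \<integral>\<^sup>+ \<xi>. \<integral>\<^sup>+ y. G (x, y, \<xi>) \<partial>lborel \<partial>lborel \<partial>lborel)"
    by (intro nn_integral_cong, subst lborel_pair.nn_integral_snd[symmetric]) auto
  also have "\<dots> = (\<integral>\<^sup>+ \<xi>. \<integral>\<^sup>+ x. \<integral>\<^sup>+ y. G (x, y, \<xi>) \<partial>lborel \<partial>lborel \<partial>lborel)"
    by (rule lborel_pair.Fubini') measurable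
  finally show ?thesis .
qed

text \<open>The squared norm of the slice at frequency \<open>\<xi>\<close>. It is the weight with
  which a multiplier is measured there.\<close>

definition zak_slice :: "nat \<Rightarrow> (real \<times> real \<Rightarrow> complex) \<Rightarrow> real \<Rightarrow> ennreal" where
  "zak_slice N Z \<xi> = (\<integral>\<^sup>+ x. ennreal ((cmod (Z (x, \<xi>)))\<^sup>2) * indicator {0..<1 / real N} x \<partial>lborel)"

lemma measurable_pair_borel:
  fixes Z :: "real \<times> real \<Rightarrow> 'b::topological_space"
  shows "Z \<in> borel_measurable borel \<Longrightarrow> Z \<in> borel_measurable (borel \<Otimes>\<^sub>M borel)"
  by (simp add: borel_prod)

lemma measurable_zak_slice [measurable]:
  assumes "Z \<in> borel_measurable borel"
  shows "zak_slice N Z \<in> borel_measurable borel"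
proof -
  note [measurable] = measurable_pair_borel[OF assms]
  show ?thesis unfolding zak_slice_def[abs_def] by measurable
qed

text \<open>The multiplier leaves the integral in \<open>x\<close>, and the frequency interval of
  length \<open>N\<close> is cut into \<open>N\<close> unit intervals folded onto one.\<close>

lemma l2sq_zak_slices:
  assumes "Z \<in> borel_measurable borel" and [measurable]: "R \<in> borel_measurable borel"
  shows "l2sq (zak_measure N) (\<lambda>t. R (snd t) * Z t) =
    (\<Sum>p<N. \<integral>\<^sup>+ \<xi>. ennreal ((cmod (R (\<xi> + real p)))\<^sup>2) * zak_slice N Z (\<xi> + real p) * indicator {0..<1} \<xi> \<partial>lborel)"
proof -
  note [measurable] = measurable_pair_borel[OF assms(1)]
  have "(\<lambda>t. ennreal ((cmod (R (snd t) * Z t))\<^sup>2)) \<in> borel_measurable (borel \<Otimes>\<^sub>M borel)" by measurable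
  then have [measurable]: "(\<lambda>t. ennreal ((cmod (R (snd t) * Z t))\<^sup>2)) \<in> borel_measurable borel"
    by (simp add: borel_prod)
  have "l2sq (zak_measure N) (\<lambda>t. R (snd t) * Z t) =
      (\<integral>\<^sup>+ \<xi>. ennreal ((cmod (R \<xi>))\<^sup>2) * zak_slice N Z \<xi> * indicator {0..<real N} \<xi> \<partial>lborel)"
    unfolding l2sq_def zak_slice_def
    by (subst nn_integral_zak_measure(2), measurable)
      (auto simp: norm_mult power_mult_distrib ennreal_mult mult.assoc nn_integral_cmult)
  also have "\<dots> = (\<Sum>p<N. \<integral>\<^sup>+ \<xi>. ennreal ((cmod (R (\<xi> + real p)))\<^sup>2) * zak_slice N Z (\<xi> + real p) * indicator {0..<1} \<xi> \<partial>lborel)"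
    by (rule nn_integral_split_unit_intervals) (use assms in measurable)
  finally show ?thesis .
qed

definition trig_sum :: "int set \<Rightarrow> (int \<Rightarrow> complex) \<Rightarrow> real \<Rightarrow> complex" where
  "trig_sum S c \<xi> = (\<Sum>k\<in>S. c k * cis (- 2 * pi * of_int k * \<xi>))"

lemma measurable_trig_sum [measurable]: "trig_sum S c \<in> borel_measurable borel"
  unfolding trig_sum_def[abs_def] by measurable

lemma trig_sum_periodic: "trig_sum S c (\<xi> + real p) = trig_sum S c \<xi>"
proof -
  have "cis (- 2 * pi * of_int k * (\<xi> + real p)) = cis (- 2 * pi * of_int k * \<xi>)" for k
  proof -
    have "cis (- 2 * pi * of_int k * (\<xi> + real p)) = cis (- 2 * pi * of_int k * \<xi>) * cis (2 * pi * of_int (- k * int p))"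
      unfolding cis_mult by (rule arg_cong[of _ _ cis]) (simp add: algebra_simps)
    also have "cis (2 * pi * of_int (- k * int p)) = 1"
      by (rule cis_multiple_2pi) (rule Ints_of_int)
    finally show ?thesis by simp
  qed
  then show ?thesis unfolding trig_sum_def by (simp only:)
qed

lemma cmod_trig_sum_le: "cmod (trig_sum S c \<xi>) \<le> (\<Sum>k\<in>S. cmod (c k))"
  unfolding trig_sum_def by (rule order_trans[OF norm_sum]) (simp add: norm_mult)

text \<open>The multiplier of translation by \<open>k / N\<close>, written
  \<open>\<omega>\<^sup>k\<close> in the overview; in general it is not 1-periodic.\<close>

definition fshift :: "nat \<Rightarrow> int \<Rightarrow> real \<Rightarrow> complex" where
  "fshift N k \<xi> = cis (- 2 * pi * (of_int k / real N) * \<xi>)"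

lemma measurable_fshift [measurable]: "fshift N k \<in> borel_measurable borel"
  unfolding fshift_def[abs_def] by measurable

text \<open>A translate by \<open>j + k / N\<close> has index \<open>N * j + k\<close> on the
  lattice of step \<open>1 / N\<close>. Both combinations thus fit into a single one over
  \<open>S <+> T\<close>, with negated coefficients on the second part.\<close>

lemma l2dist2_zak:
  fixes S T :: "int set" and k :: int and c d :: "int \<Rightarrow> complex"
  assumes "sq_int f" "N > 0" "is_zak_L2 N f Z" "finite S" "finite T"
  defines "R \<equiv> \<lambda>\<xi>. fshift N k \<xi> * trig_sum S c \<xi> - trig_sum T d \<xi>"
    and "D \<equiv> l2dist2 (transl (of_int k / real N) (\<lambda>x. \<Sum>j\<in>S. c j * transl (of_int j) f x))
           (\<lambda>x. \<Sum>j\<in>T. d j * transl (of_int j) f x)"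
  shows "l2sq (zak_measure N) (\<lambda>t. R (snd t) * Z t) \<le> 4 * ennreal (1 / real N) * D"
    and "D \<le> 4 * ennreal (real N) * l2sq (zak_measure N) (\<lambda>t. R (snd t) * Z t)"
proof -
  let ?I = "S <+> T" and ?c = "case_sum c (\<lambda>j. - d j)"
    and ?r = "case_sum (\<lambda>j. int N * j + k) (\<lambda>j. int N * j)"
  have 1: "R \<xi> = zak_mult N ?I ?c ?r \<xi>" for \<xi>
  proof -
    have "cis (- 2 * pi * (of_int (int N * j + k) / real N) * \<xi>) = fshift N k \<xi> * cis (- 2 * pi * of_int j * \<xi>)" for j
      unfolding fshift_def cis_mult using assms(2)
      by (intro arg_cong[of _ _ cis]) (simp add: field_simps)
    moreover have "cis (- 2 * pi * (of_int (int N * j) / real N) * \<xi>) = cis (- 2 * pi * of_int j * \<xi>)" for j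
      using assms(2) by simp
    ultimately show ?thesis
      using assms(4,5) unfolding R_def zak_mult_def trig_sum_def
      by (simp add: sum.Plus sum_distrib_left sum_negf mult_ac del: of_int_mult of_int_add)
  qed
  have 2: "D = l2sq lborel (shift_comb N ?I ?c ?r f)"
    unfolding D_def l2dist2_eq_l2sq
  proof (rule l2sq_cong)
    fix x :: real
    have "f (x - of_int k / real N - of_int j) = f (x - of_int (int N * j + k) / real N)" for j
      using assms(2) by (intro arg_cong[of _ _ f]) (simp add: field_simps)
    moreover have "of_int (int N * j) / real N = real_of_int j" for j
      using assms(2) by simp
    ultimately show "transl (of_int k / real N) (\<lambda>x. \<Sum>j\<in>S. c j * transl (of_int j) f x) x -
        (\<Sum>j\<in>T. d j * transl (of_int j) f x) = shift_comb N ?I ?c ?r f x"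
      using assms(4,5) unfolding transl_def shift_comb_def
      by (simp add: sum.Plus sum_negf del: of_int_mult of_int_add)
  qed
  have fin: "finite ?I" using assms(4,5) by simp
  show "l2sq (zak_measure N) (\<lambda>t. R (snd t) * Z t) \<le> 4 * ennreal (1 / real N) * D"
    "D \<le> 4 * ennreal (real N) * l2sq (zak_measure N) (\<lambda>t. R (snd t) * Z t)"
    unfolding 1 2 by (rule l2sq_zak_mult[OF assms(1-3) fin])+
qed

section \<open>Invariance forces the slices to be disjoint\<close>

lemma fshift_separates:
  assumes "p < N" "q < N" "p \<noteq> q"
  shows "\<exists>\<delta>>0. \<forall>\<xi>. cmod (fshift N 1 (\<xi> + real p) - fshift N 1 (\<xi> + real q)) = \<delta>"
proof (intro exI conjI allI)
  \<comment> \<open>The gap does not depend on \<open>\<xi>\<close>, since moving the frequency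
    multiplies both values by the same unimodular factor; hence its value at
    \<open>\<xi> = 0\<close> serves throughout.\<close>
  let ?\<delta> = "cmod (fshift N 1 (real p) - fshift N 1 (real q))"
  have mult: "fshift N 1 (\<xi> + a) = fshift N 1 \<xi> * fshift N 1 a" for \<xi> a
    unfolding fshift_def cis_mult by (rule arg_cong[of _ _ cis]) (simp add: algebra_simps add_divide_distrib)
  show "cmod (fshift N 1 (\<xi> + real p) - fshift N 1 (\<xi> + real q)) = ?\<delta>" for \<xi>
    unfolding mult right_diff_distrib[symmetric] norm_mult by (simp add: fshift_def)
  have "fshift N 1 (real p) \<noteq> fshift N 1 (real q)"
  proof
    assume "fshift N 1 (real p) = fshift N 1 (real q)"
    \<comment> \<open>Conjugation brings the angles into \<open>[0, 2 * pi)\<close>, where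
      \<open>Arg2pi\<close> recovers them.\<close>
    then have "cis (2 * pi * (real p / real N)) = cis (2 * pi * (real q / real N))"
      unfolding fshift_def using cis_cnj[of "2 * pi * (real p / real N)"] cis_cnj[of "2 * pi * (real q / real N)"]
      by (metis (no_types, lifting) complex_cnj_cancel_iff mult.commute mult_1 mult_minus_left of_int_1 times_divide_eq_left times_divide_eq_right)
    then have "Arg2pi (cis (2 * pi * (real p / real N))) = Arg2pi (cis (2 * pi * (real q / real N)))"
      by simp
    moreover have "Arg2pi (cis (2 * pi * (real a / real N))) = 2 * pi * (real a / real N)" if "a < N" for a
      by (rule Arg2pi_unique[of 1]) (use that in \<open>auto simp: cis_conv_exp field_simps\<close>)
    ultimately show False using assms by simp
  qed
  then show "?\<delta> > 0" by simp
qed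

text \<open>A 1-periodic function takes one value at \<open>\<xi> + p\<close> and
  \<open>\<xi> + q\<close>, while the multiplier takes two values at distance
  \<open>\<delta>\<close>. The errors at the two frequencies therefore cannot both be small, and
  smallness of the weighted total error forces one of the weights to vanish.\<close>

lemma zak_slices_orthogonal_if_invariant:
  assumes "sq_int \<psi>" "N > 0" "is_zak_L2 N \<psi> Z" "p < N" "q < N" "p \<noteq> q"
    and inv: "transl (1 / real N) \<psi> \<in> int_shift_space \<psi>"
  shows "AE t in lborel. case t of (x, y, \<xi>) \<Rightarrow>
      x \<in> {0..<1 / real N} \<longrightarrow> y \<in> {0..<1 / real N} \<longrightarrow> \<xi> \<in> {0..<1} \<longrightarrow>
      Z (x, \<xi> + real p) * Z (y, \<xi> + real q) = 0"
proof -
  have Zb: "Z \<in> borel_measurable borel" using assms(3) by (simp add: is_zak_L2_def)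
  note [measurable] = measurable_pair_borel[OF Zb] Zb
  obtain \<delta> where \<delta>: "\<delta> > 0" "\<And>\<xi>. cmod (fshift N 1 (\<xi> + real p) - fshift N 1 (\<xi> + real q)) = \<delta>"
    using fshift_separates[OF assms(4-6)] by blast
  define a where "a \<xi> x = ennreal ((cmod (Z (x, \<xi>)))\<^sup>2) * indicator {0..<1 / real N} x" for \<xi> x
  have [measurable]: "case_prod a \<in> borel_measurable (borel \<Otimes>\<^sub>M borel)"
    unfolding a_def by measurable
  define G where "G = (\<lambda>(x, y, \<xi>). ennreal (\<delta>\<^sup>2 * min ((cmod (Z (x, \<xi> + real p)))\<^sup>2) ((cmod (Z (y, \<xi> + real q)))\<^sup>2))
      * (indicator {0..<1 / real N} x * indicator {0..<1 / real N} y * indicator {0..<1} \<xi>))"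
  have Gm [measurable]: "G \<in> borel_measurable (borel \<Otimes>\<^sub>M borel \<Otimes>\<^sub>M borel)"
    unfolding G_def by measurable
  \<comment> \<open>The minimum, unlike the product, is dominated by each factor, so \<open>G\<close> is controlled by the two slice errors.\<close>
  have "nn_integral lborel G \<le> ennreal e" if "e > 0" for e
  proof -
    \<comment> \<open>The norm comparison costs a factor of at most 4, leaving \<open>e / 4\<close>
      for each slice error; two such errors, each doubled, add up to \<open>e\<close>.\<close>
    have "e / 16 > 0" using that by simp
    then obtain T d where T: "finite T"
      "l2dist2 (transl (1 / real N) \<psi>) (\<lambda>x. \<Sum>j\<in>T. d j * transl (of_int j) \<psi> x) < ennreal (e / 16)"
      using inv unfolding int_shift_space_def by blast
    define R where "R \<xi> = fshift N 1 \<xi> - trig_sum T d \<xi>" for \<xi>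
    have [measurable]: "R \<in> borel_measurable borel" unfolding R_def by measurable
    let ?E = "\<lambda>p. \<integral>\<^sup>+ \<xi>. ennreal ((cmod (R (\<xi> + real p)))\<^sup>2) * zak_slice N Z (\<xi> + real p) * indicator {0..<1} \<xi> \<partial>lborel"
    have "l2sq (zak_measure N) (\<lambda>t. R (snd t) * Z t) \<le> 4 * ennreal (1 / real N) *
        l2dist2 (transl (1 / real N) \<psi>) (\<lambda>x. \<Sum>j\<in>T. d j * transl (of_int j) \<psi> x)"
      \<comment> \<open>The combination over \<open>{0}\<close> with coefficient 1 is
        \<open>\<psi>\<close> itself, so its translate by \<open>1 / N\<close> is the function being
        approximated.\<close>
      using l2dist2_zak(1)[OF assms(1-3) _ T(1), of "{0}" 1 "\<lambda>_. 1" d]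
      by (simp add: R_def trig_sum_def transl_def)
    also have "\<dots> \<le> 4 * 1 * ennreal (e / 16)"
      using T(2) assms(2) by (intro mult_mono) auto
    also have "\<dots> = ennreal (e / 4)"
      using that ennreal_mult'[of 4 "e / 16"] by simp
    finally have sum_le: "(\<Sum>p<N. ?E p) \<le> ennreal (e / 4)"
      unfolding l2sq_zak_slices[OF Zb \<open>R \<in> borel_measurable borel\<close>] .
    have E_le: "?E p' \<le> ennreal (e / 4)" if "p' < N" for p'
      by (rule order_trans[OF member_le_sum sum_le]) (use that in auto)
    have vol: "(\<integral>\<^sup>+ y. indicator {0..<1 / real N} y \<partial>lborel) \<le> 1"
      using assms(2) by simp
    have "nn_integral lborel G = (\<integral>\<^sup>+ \<xi>. \<integral>\<^sup>+ x. \<integral>\<^sup>+ y. G (x, y, \<xi>) \<partial>lborel \<partial>lborel \<partial>lborel)"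
      by (rule nn_integral_lborel_triple) measurable
    also have "\<dots> \<le> (\<integral>\<^sup>+ \<xi>. \<integral>\<^sup>+ x. \<integral>\<^sup>+ y.
        2 * ennreal ((cmod (R (\<xi> + real p)))\<^sup>2) * indicator {0..<1} \<xi> * a (\<xi> + real p) x * indicator {0..<1 / real N} y
      + 2 * ennreal ((cmod (R (\<xi> + real q)))\<^sup>2) * indicator {0..<1} \<xi> * a (\<xi> + real q) y * indicator {0..<1 / real N} x
        \<partial>lborel \<partial>lborel \<partial>lborel)"
    proof (intro nn_integral_mono)
      fix \<xi> x y :: real
      let ?zp = "(cmod (Z (x, \<xi> + real p)))\<^sup>2" and ?zq = "(cmod (Z (y, \<xi> + real q)))\<^sup>2"
      let ?rp = "(cmod (R (\<xi> + real p)))\<^sup>2" and ?rq = "(cmod (R (\<xi> + real q)))\<^sup>2"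
      have "\<delta>\<^sup>2 = (cmod (R (\<xi> + real p) + - R (\<xi> + real q)))\<^sup>2"
        unfolding \<delta>(2)[of \<xi>, symmetric] R_def by (simp add: trig_sum_periodic)
      also have "\<dots> \<le> 2 * ?rp + 2 * ?rq"
        using cmod_add_sq_le[of "R (\<xi> + real p)" "- R (\<xi> + real q)"] by simp
      finally have "\<delta>\<^sup>2 * min ?zp ?zq \<le> (2 * ?rp + 2 * ?rq) * min ?zp ?zq"
        by (rule mult_right_mono) simp
      also have "\<dots> = 2 * ?rp * min ?zp ?zq + 2 * ?rq * min ?zp ?zq"
        by (rule distrib_right)
      also have "\<dots> \<le> 2 * ?rp * ?zp + 2 * ?rq * ?zq"
        by (intro add_mono mult_left_mono) auto
      finally have "ennreal (\<delta>\<^sup>2 * min ?zp ?zq) \<le> ennreal (2 * ?rp * ?zp + 2 * ?rq * ?zq)"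
        by (rule ennreal_leI)
      also have "\<dots> = 2 * ennreal ?rp * ennreal ?zp + 2 * ennreal ?rq * ennreal ?zq"
        by (simp add: ennreal_mult)
      finally show "G (x, y, \<xi>) \<le>
        2 * ennreal ?rp * indicator {0..<1} \<xi> * a (\<xi> + real p) x * indicator {0..<1 / real N} y
        + 2 * ennreal ?rq * indicator {0..<1} \<xi> * a (\<xi> + real q) y * indicator {0..<1 / real N} x"
        by (auto simp: G_def a_def indicator_def)
    qed
    also have "\<dots> = 2 * ?E p * (\<integral>\<^sup>+ y. indicator {0..<1 / real N} y \<partial>lborel)
        + 2 * ?E q * (\<integral>\<^sup>+ y. indicator {0..<1 / real N} y \<partial>lborel)"
    proof -
      have sl: "(\<integral>\<^sup>+ x. a \<xi> x \<partial>lborel) = zak_slice N Z \<xi>" for \<xi>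
        by (simp add: a_def zak_slice_def)
      define V where "V = (\<integral>\<^sup>+ y. indicator {0..<1 / real N} y \<partial>(lborel :: real measure))"
      have "(\<integral>\<^sup>+ x. \<integral>\<^sup>+ y.
          2 * ennreal ((cmod (R (\<xi> + real p)))\<^sup>2) * indicator {0..<1} \<xi> * a (\<xi> + real p) x * indicator {0..<1 / real N} y
        + 2 * ennreal ((cmod (R (\<xi> + real q)))\<^sup>2) * indicator {0..<1} \<xi> * a (\<xi> + real q) y * indicator {0..<1 / real N} x
          \<partial>lborel \<partial>lborel) =
          2 * (ennreal ((cmod (R (\<xi> + real p)))\<^sup>2) * zak_slice N Z (\<xi> + real p) * indicator {0..<1} \<xi>) * V
        + 2 * (ennreal ((cmod (R (\<xi> + real q)))\<^sup>2) * zak_slice N Z (\<xi> + real q) * indicator {0..<1} \<xi>) * V" for \<xi>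
        unfolding V_def
        by (simp add: nn_integral_add nn_integral_cmult nn_integral_multc sl mult_ac
            del: nn_integral_indicator emeasure_lborel_Ico)
      then show ?thesis
        unfolding V_def[symmetric] by (simp add: nn_integral_add nn_integral_cmult nn_integral_multc)
    qed
    also have "\<dots> \<le> 2 * ennreal (e / 4) * 1 + 2 * ennreal (e / 4) * 1"
      using E_le assms(4,5) by (intro add_mono mult_mono vol) auto
    also have "\<dots> = ennreal e"
      using that ennreal_mult'[of 2 "e / 4"] ennreal_plus[of "e/2" "e/2"] by simp
    finally show ?thesis .
  qed
  then have "nn_integral lborel G = 0"
    by (metis ennreal_le_epsilon add_0 le_zero_eq)
  moreover have "G \<in> borel_measurable lborel" using Gm by (simp add: borel_prod)
  ultimately have "AE t in lborel. G t = 0" by (simp add: nn_integral_0_iff_AE)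
  then show ?thesis
  proof eventually_elim
    case (elim t)
    then show ?case using \<delta>(1)
      by (auto simp: G_def split: prod.splits) (auto simp: min_def split: if_splits)
  qed
qed

section \<open>Disjoint slices imply invariance\<close>

lemma zak_slice_mult_eq_0:
  assumes Zb: "Z \<in> borel_measurable borel"
    and ae: "AE t in lborel. case t of (x, y, \<xi>) \<Rightarrow>
      x \<in> {0..<1 / real N} \<longrightarrow> y \<in> {0..<1 / real N} \<longrightarrow> \<xi> \<in> {0..<1} \<longrightarrow>
      Z (x, \<xi> + real p) * Z (y, \<xi> + real q) = 0"
  shows "AE \<xi> in lborel. \<xi> \<in> {0..<1} \<longrightarrow> zak_slice N Z (\<xi> + real p) * zak_slice N Z (\<xi> + real q) = 0"
proof -
  note [measurable] = measurable_pair_borel[OF Zb] Zb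
  define a where "a \<xi> x = ennreal ((cmod (Z (x, \<xi>)))\<^sup>2) * indicator {0..<1 / real N} x" for \<xi> x
  have [measurable]: "case_prod a \<in> borel_measurable (borel \<Otimes>\<^sub>M borel)"
    unfolding a_def by measurable
  have sl: "(\<integral>\<^sup>+ x. a \<xi> x \<partial>lborel) = zak_slice N Z \<xi>" for \<xi>
    by (simp add: a_def zak_slice_def)
  \<comment> \<open>For fixed \<open>\<xi>\<close> the variables \<open>x\<close> and
    \<open>y\<close> separate, so integrating over both turns the pointwise product into the product
    of the two slice norms.\<close>
  define G where "G = (\<lambda>(x, y, \<xi>). indicator {0..<1} \<xi> * (a (\<xi> + real p) x * a (\<xi> + real q) y))"
  have Gm [measurable]: "G \<in> borel_measurable (borel \<Otimes>\<^sub>M borel \<Otimes>\<^sub>M borel)"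
    unfolding G_def by measurable
  then have Gb: "G \<in> borel_measurable lborel" by (simp add: borel_prod)
  have "AE t in lborel. G t = 0"
    using ae
  proof eventually_elim
    case (elim t)
    then show ?case
      by (auto simp: G_def a_def indicator_def split: prod.splits)
  qed
  then have "nn_integral lborel G = 0" using Gb by (simp add: nn_integral_0_iff_AE)
  then have "(\<integral>\<^sup>+ \<xi>. \<integral>\<^sup>+ x. \<integral>\<^sup>+ y. G (x, y, \<xi>) \<partial>lborel \<partial>lborel \<partial>lborel) = 0"
    using nn_integral_lborel_triple[OF Gm] by simp
  also have "(\<integral>\<^sup>+ \<xi>. \<integral>\<^sup>+ x. \<integral>\<^sup>+ y. G (x, y, \<xi>) \<partial>lborel \<partial>lborel \<partial>lborel) =
      (\<integral>\<^sup>+ \<xi>. indicator {0..<1} \<xi> * (zak_slice N Z (\<xi> + real p) * zak_slice N Z (\<xi> + real q)) \<partial>lborel)"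
    by (simp add: G_def nn_integral_cmult nn_integral_multc sl)
  finally show ?thesis
    by (subst (asm) nn_integral_0_iff_AE) (auto elim!: eventually_mono simp: indicator_def split: if_splits)
qed

text \<open>The trigonometric factor \<open>trig_sum S c\<close> is included so that a whole finite
  combination of translates of \<open>\<psi>\<close> is handled in one approximation.\<close>

lemma zak_mult_approx_if_orthogonal:
  assumes Zb: "Z \<in> borel_measurable borel" and fin: "l2sq (zak_measure N) Z < \<infinity>" and "e > 0"
    and orth: "\<And>p q. p < N \<Longrightarrow> q < N \<Longrightarrow> p \<noteq> q \<Longrightarrow>
      AE \<xi> in lborel. \<xi> \<in> {0..<1} \<longrightarrow> zak_slice N Z (\<xi> + real p) * zak_slice N Z (\<xi> + real q) = 0"
  shows "\<exists>T d. finite T \<and>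
    l2sq (zak_measure N) (\<lambda>t. (fshift N k (snd t) * trig_sum S c (snd t) - trig_sum T d (snd t)) * Z t) < e"
proof -
  note [measurable] = Zb
  let ?w = "\<lambda>p \<xi>. zak_slice N Z (\<xi> + real p)"
  define W where "W \<xi> = (\<Sum>p<N. ?w p \<xi>)" for \<xi>
  have [measurable]: "W \<in> borel_measurable borel" unfolding W_def by measurable
  \<comment> \<open>At almost every \<open>\<xi>\<close> at most one summand is present, so
    \<open>m\<close> picks the value of the multiplier on the active slice. Written as a sum over
    all \<open>p\<close>, it is visibly measurable and bounded.\<close>
  define m where "m \<xi> = (\<Sum>p<N. if ?w p \<xi> \<noteq> 0 then fshift N k (\<xi> + real p) * trig_sum S c \<xi> else 0)" for \<xi>
  have m_meas: "m \<in> borel_measurable borel" unfolding m_def by measurable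
  have m_bdd: "cmod (m \<xi>) \<le> real N * (\<Sum>k\<in>S. cmod (c k))" for \<xi>
  proof -
    have "cmod (m \<xi>) \<le> (\<Sum>p<N. (\<Sum>k\<in>S. cmod (c k)))"
      unfolding m_def
      by (rule order_trans[OF norm_sum], rule sum_mono)
        (auto simp: norm_mult fshift_def cmod_trig_sum_le sum_nonneg)
    then show ?thesis by simp
  qed
  have "l2sq (zak_measure N) Z = (\<Sum>p<N. \<integral>\<^sup>+ \<xi>. ?w p \<xi> * indicator {0..<1} \<xi> \<partial>lborel)"
    using l2sq_zak_slices[OF Zb, of "\<lambda>_. 1" N] by simp
  also have "\<dots> = (\<integral>\<^sup>+ \<xi>. W \<xi> * indicator {0..<1} \<xi> \<partial>lborel)"
    unfolding W_def sum_distrib_right by (rule nn_integral_sum[symmetric]) measurable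
  finally have W_fin: "(\<integral>\<^sup>+ \<xi>. W \<xi> * indicator {0..<1} \<xi> \<partial>lborel) < \<infinity>" using fin by simp
  obtain P where "trig_poly P"
    and P: "(\<integral>\<^sup>+ \<xi>. ennreal ((cmod (m \<xi> - P \<xi>))\<^sup>2) * W \<xi> * indicator {0..<1} \<xi> \<partial>lborel) < e"
    using trig_poly_dense[OF m_meas m_bdd _ W_fin \<open>e > 0\<close>] \<open>W \<in> borel_measurable borel\<close> by blast
  then obtain T d where T: "finite T" "P = trig_sum T d"
    unfolding trig_poly_def trig_sum_def[abs_def] by blast
  define R where "R \<xi> = fshift N k \<xi> * trig_sum S c \<xi> - trig_sum T d \<xi>" for \<xi>
  have R_meas [measurable]: "R \<in> borel_measurable borel" unfolding R_def by measurable
  have "AE \<xi> in lborel. \<forall>p\<in>{..<N}. \<forall>q\<in>{..<N}. p \<noteq> q \<longrightarrow> \<xi> \<in> {0..<1} \<longrightarrow> ?w p \<xi> * ?w q \<xi> = 0"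
    using orth by (intro AE_finite_allI) auto
  then have ae: "AE \<xi> in lborel. \<forall>p<N. \<xi> \<in> {0..<1} \<longrightarrow> ?w p \<xi> \<noteq> 0 \<longrightarrow> m \<xi> = fshift N k (\<xi> + real p) * trig_sum S c \<xi>"
  proof eventually_elim
    case (elim \<xi>)
    show ?case
    proof (intro allI impI)
      fix p assume p: "p < N" "\<xi> \<in> {0..<1}" "?w p \<xi> \<noteq> 0"
      then have "?w q \<xi> = 0" if "q < N" "q \<noteq> p" for q
        using elim that by fastforce
      then have "m \<xi> = (\<Sum>q<N. if q = p then fshift N k (\<xi> + real p) * trig_sum S c \<xi> else 0)"
        unfolding m_def using p by (intro sum.cong) auto
      then show "m \<xi> = fshift N k (\<xi> + real p) * trig_sum S c \<xi>" using p by simp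
    qed
  qed
  have "l2sq (zak_measure N) (\<lambda>t. R (snd t) * Z t) =
      (\<Sum>p<N. \<integral>\<^sup>+ \<xi>. ennreal ((cmod (R (\<xi> + real p)))\<^sup>2) * ?w p \<xi> * indicator {0..<1} \<xi> \<partial>lborel)"
    by (rule l2sq_zak_slices[OF Zb R_meas])
  \<comment> \<open>Where the weight is nonzero, \<open>m\<close> equals the shifted multiplier and
    periodicity lets \<open>P\<close> be evaluated at \<open>\<xi>\<close>; elsewhere both
    integrands vanish. One function \<open>P\<close> thus serves all \<open>N\<close> slices, and
    the weights add up to \<open>W\<close>.\<close>
  also have "\<dots> = (\<Sum>p<N. \<integral>\<^sup>+ \<xi>. ennreal ((cmod (m \<xi> - P \<xi>))\<^sup>2) * ?w p \<xi> * indicator {0..<1} \<xi> \<partial>lborel)"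
  proof (intro sum.cong refl nn_integral_cong_AE)
    fix p assume "p \<in> {..<N}"
    then show "AE \<xi> in lborel. ennreal ((cmod (R (\<xi> + real p)))\<^sup>2) * ?w p \<xi> * indicator {0..<1} \<xi> =
        ennreal ((cmod (m \<xi> - P \<xi>))\<^sup>2) * ?w p \<xi> * indicator {0..<1} \<xi>"
      using ae by (auto elim!: eventually_mono simp: R_def T(2) trig_sum_periodic indicator_def)
  qed
  also have "\<dots> = (\<integral>\<^sup>+ \<xi>. ennreal ((cmod (m \<xi> - P \<xi>))\<^sup>2) * W \<xi> * indicator {0..<1} \<xi> \<partial>lborel)"
    unfolding W_def sum_distrib_left sum_distrib_right T(2)
    by (rule nn_integral_sum[symmetric]) (use m_meas in measurable)
  also note P
  finally show ?thesis using T(1) unfolding R_def by blast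
qed

lemma int_shift_space_transl_invariant:
  assumes "sq_int \<psi>" "N > 0" "is_zak_L2 N \<psi> Z"
    and orth: "\<And>p q. p < N \<Longrightarrow> q < N \<Longrightarrow> p \<noteq> q \<Longrightarrow>
      AE \<xi> in lborel. \<xi> \<in> {0..<1} \<longrightarrow> zak_slice N Z (\<xi> + real p) * zak_slice N Z (\<xi> + real q) = 0"
    and f: "f \<in> int_shift_space \<psi>"
  shows "transl (of_int k / real N) f \<in> int_shift_space \<psi>"
proof -
  have Zb: "Z \<in> borel_measurable borel" and Zfin: "l2sq (zak_measure N) Z < \<infinity>"
    using assms(3) unfolding is_zak_L2_def l2sq_zak_measure[symmetric] by auto
  have [measurable]: "\<psi> \<in> borel_measurable borel" using assms(1) by (simp add: sq_int_iff)
  have "sq_int f" using f by (simp add: int_shift_space_def)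
  then have fm [measurable]: "f \<in> borel_measurable borel" and ffin: "l2sq lborel f < \<infinity>"
    by (auto simp: sq_int_iff)
  let ?h = "of_int k / real N"
  have tm [measurable]: "transl h g \<in> borel_measurable borel" if "g \<in> borel_measurable borel" for g h
  proof -
    note [measurable] = that
    show ?thesis unfolding transl_def by measurable
  qed
  have "sq_int (transl ?h f)"
    using l2sq_transl[OF fm, of ?h] ffin tm[OF fm] by (simp add: sq_int_iff transl_def)
  moreover have "\<exists>T d. finite (T :: int set) \<and>
      l2dist2 (transl ?h f) (\<lambda>x. \<Sum>j\<in>T. d j * transl (of_int j) \<psi> x) < ennreal \<epsilon>" if "\<epsilon> > 0" for \<epsilon>
  proof -
    \<comment> \<open>Error budget: \<open>\<epsilon> / 8\<close> for replacing \<open>f\<close> by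
      a finite combination \<open>g\<close>, and \<open>\<epsilon> / 4\<close> for approximating the
      translate of \<open>g\<close>; both are doubled, for a total of
      \<open>3 * \<epsilon> / 4\<close>.\<close>
    have "\<epsilon> / 8 > 0" using that by simp
    then obtain S c where S: "finite (S :: int set)"
      "l2dist2 f (\<lambda>x. \<Sum>j\<in>S. c j * transl (of_int j) \<psi> x) < ennreal (\<epsilon> / 8)"
      using f unfolding int_shift_space_def by blast
    define g where "g x = (\<Sum>j\<in>S. c j * transl (of_int j) \<psi> x)" for x
    have gm [measurable]: "g \<in> borel_measurable borel"
      unfolding g_def by measurable
    \<comment> \<open>Returning from the Zak side costs the factor \<open>4 * N\<close>, which turns
      this tolerance into \<open>\<epsilon> / 4\<close>.\<close>
    have "ennreal (\<epsilon> / (16 * real N)) > 0" using that assms(2) by simp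
    then obtain T d where T: "finite T"
      "l2sq (zak_measure N) (\<lambda>t. (fshift N k (snd t) * trig_sum S c (snd t) - trig_sum T d (snd t)) * Z t)
        < ennreal (\<epsilon> / (16 * real N))"
      using zak_mult_approx_if_orthogonal[OF Zb Zfin _ orth] by blast
    define u where "u x = (\<Sum>j\<in>T. d j * transl (of_int j) \<psi> x)" for x
    have um [measurable]: "u \<in> borel_measurable borel"
      unfolding u_def by measurable
    have "l2dist2 (transl ?h g) u \<le> 4 * ennreal (real N) * ennreal (\<epsilon> / (16 * real N))"
      unfolding g_def u_def
      by (rule order_trans[OF l2dist2_zak(2)[OF assms(1-3) S(1) T(1)]], rule mult_left_mono)
        (use T(2) in auto)
    also have "\<dots> = ennreal (\<epsilon> / 4)"
    proof -
      have "4 * ennreal (real N) * ennreal (\<epsilon> / (16 * real N)) = ennreal (4 * real N * (\<epsilon> / (16 * real N)))"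
        using that by (simp only: ennreal_mult' ennreal_numeral zero_le_numeral mult_nonneg_nonneg of_nat_0_le_iff)
      then show ?thesis using assms(2) by simp
    qed
    finally have 2: "l2dist2 (transl ?h g) u \<le> ennreal (\<epsilon> / 4)" .
    have "l2dist2 (transl ?h f) (transl ?h g) = l2dist2 f g"
      unfolding l2dist2_eq_l2sq transl_def using l2sq_transl[of "\<lambda>x. f x - g x" ?h] by simp
    then have 1: "l2dist2 (transl ?h f) (transl ?h g) < ennreal (\<epsilon> / 8)"
      using S(2) by (simp add: g_def[abs_def])
    have "l2dist2 (transl ?h f) u \<le> 2 * l2dist2 (transl ?h f) (transl ?h g) + 2 * l2dist2 (transl ?h g) u"
      unfolding l2dist2_eq_l2sq by (rule l2sq_triangle) auto
    also have "\<dots> \<le> 2 * ennreal (\<epsilon> / 8) + 2 * ennreal (\<epsilon> / 4)"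
      using 1 2 by (intro add_mono mult_left_mono) auto
    also have "\<dots> = ennreal (\<epsilon> / 4 + \<epsilon> / 2)"
    proof -
      have "2 * ennreal (\<epsilon> / 8) = ennreal (\<epsilon> / 4)" "2 * ennreal (\<epsilon> / 4) = ennreal (\<epsilon> / 2)"
        using ennreal_mult'[of 2 "\<epsilon> / 8"] ennreal_mult'[of 2 "\<epsilon> / 4"] by simp_all
      then show ?thesis using that by (simp only: ennreal_plus[symmetric])
    qed
    also have "\<dots> < ennreal \<epsilon>"
      using that by (intro ennreal_lessI) auto
    finally show ?thesis using T(1) unfolding u_def[abs_def] by blast
  qed
  ultimately show ?thesis unfolding int_shift_space_def by blast
qed

lemma self_in_int_shift_space:
  assumes "sq_int \<psi>"
  shows "\<psi> \<in> int_shift_space \<psi>"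
proof -
  have "l2dist2 \<psi> (\<lambda>x. \<Sum>k\<in>{0::int}. 1 * transl (of_int k) \<psi> x) = 0"
    by (simp add: l2dist2_def transl_def)
  then show ?thesis
    using assms unfolding int_shift_space_def
    by (auto intro!: exI[of _ "{0::int}"] exI[of _ "\<lambda>_. 1"])
qed

theorem theorem1p1:
  fixes \<psi> :: "real \<Rightarrow> complex" and N :: nat
  assumes "sq_int \<psi>"
    and "\<not> (AE x in lborel. \<psi> x = 0)"
    and "N > 1"
  shows "(\<forall>f \<in> int_shift_space \<psi>. \<forall>k :: int.
            transl (of_int k / real N) f \<in> int_shift_space \<psi>)
     \<longleftrightarrow>
         (\<forall>p q :: nat. p < N \<longrightarrow> q < N \<longrightarrow> p \<noteq> q \<longrightarrow>
            (AE t in lborel. case t of (x, y, \<xi>) \<Rightarrow>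
               x \<in> {0..<1 / real N} \<longrightarrow> y \<in> {0..<1 / real N} \<longrightarrow> \<xi> \<in> {0..<1} \<longrightarrow>
               zakN N \<psi> (x, \<xi> + real p) * zakN N \<psi> (y, \<xi> + real q) = 0))"
proof -
  have N: "N > 0" using assms(3) by simp
  \<comment> \<open>\<open>zakN\<close> is a Hilbert choice, so it has the defining property only
    because an extension exists.\<close>
  have Z: "is_zak_L2 N \<psi> (zakN N \<psi>)"
    unfolding zakN_def by (rule someI_ex[OF is_zak_L2_exists[OF assms(1) N]])
  then have Zb: "zakN N \<psi> \<in> borel_measurable borel" by (simp add: is_zak_L2_def)
  show ?thesis
  proof (intro iffI allI impI ballI)
    fix p q :: nat
    assume inv: "\<forall>f \<in> int_shift_space \<psi>. \<forall>k :: int. transl (of_int k / real N) f \<in> int_shift_space \<psi>"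
      and pq: "p < N" "q < N" "p \<noteq> q"
    \<comment> \<open>A single translate, \<open>k = 1\<close> applied to the generator, already
      yields the orthogonality of all slices.\<close>
    have "transl (of_int 1 / real N) \<psi> \<in> int_shift_space \<psi>"
      using inv self_in_int_shift_space[OF assms(1)] by blast
    then have "transl (1 / real N) \<psi> \<in> int_shift_space \<psi>" by simp
    then show "AE t in lborel. case t of (x, y, \<xi>) \<Rightarrow>
        x \<in> {0..<1 / real N} \<longrightarrow> y \<in> {0..<1 / real N} \<longrightarrow> \<xi> \<in> {0..<1} \<longrightarrow>
        zakN N \<psi> (x, \<xi> + real p) * zakN N \<psi> (y, \<xi> + real q) = 0"
      by (rule zak_slices_orthogonal_if_invariant[OF assms(1) N Z pq])
  next
    fix f and k :: int
    assume "\<forall>p q :: nat. p < N \<longrightarrow> q < N \<longrightarrow> p \<noteq> q \<longrightarrow>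
            (AE t in lborel. case t of (x, y, \<xi>) \<Rightarrow>
               x \<in> {0..<1 / real N} \<longrightarrow> y \<in> {0..<1 / real N} \<longrightarrow> \<xi> \<in> {0..<1} \<longrightarrow>
               zakN N \<psi> (x, \<xi> + real p) * zakN N \<psi> (y, \<xi> + real q) = 0)"
      and "f \<in> int_shift_space \<psi>"
    then show "transl (of_int k / real N) f \<in> int_shift_space \<psi>"
      by (intro int_shift_space_transl_invariant[OF assms(1) N Z] zak_slice_mult_eq_0[OF Zb]) auto
  qed
qed

end
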